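(* Let $1\le m<n$ be integers, let $T$ be a real $(n\times m)$-matrix of full rank $m$ with singular values $\sigma_1,\ldots,\sigma_m$, and let $$F(\delta)=\mathbb{P}\big(\{\omega\in\mathbb{R}^n \mid \|T^t\omega\|^2\leq\delta\|\omega\|^2\}\big),\quad \delta\in\mathbb{R}.$$ If $n-m>2$, this distribution possesses the density function $f$ (that is, $F(\delta)=\int_{-\infty}^{\delta}f(t)\,dt$ for all $\delta$) that vanishes for $t\leq 0$ and is, for arguments $t>0$, given by $$f(t)=\frac{1}{B(\alpha,\beta)}\,\frac{1}{m\nu_m}\int_{S^{m-1}}\frac{t^{\alpha-1}R\big(1-t\,\|\Sigma_0^{-1}\eta\|^2\big)^{\beta-1}}{\det\Sigma_0}\,d\eta,$$ where $\Sigma_0=\mathrm{diag}(\sigma_1,\ldots,\sigma_m)$ is the $(m\times m)$-diagonal matrix with the singular values of $T$ on its diagonal, $$\alpha=\frac{m}{2},\quad \beta=\frac{n-m}{2},$$ $R(t)=\max(0,t)$, and $B$ is Euler's beta function.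
   Context: $\|\cdot\|$ is the Euclidean norm, $T^t$ is the transpose of $T$, $S^{d-1}$ is the unit sphere of $\mathbb{R}^d$, $\nu_d$ is the volume of the unit ball of $\mathbb{R}^d$ (so $d\nu_d$ is the area of $S^{d-1}$), and $d\eta$ denotes integration with respect to the surface measure on the sphere. For Borel sets $M\subseteq\mathbb{R}^n$, $\mathbb{P}(M)=\frac{1}{n\nu_n}\int_{M\cap S^{n-1}}d\eta$. *)

theory Defs
  imports "HOL-Analysis.Analysis"
begin

(* Surface measure of the unit sphere, as a Borel measure on the ambient space that is
   concentrated on the sphere.  The area of a Borel set A of directions is d times the volume of
   the cone {r * x | x in A, 0 < r < 1} over A; this is the unique measure for which integration
   in polar coordinates, with volume element r^(d-1) dr d eta, holds.  For d = 1 it is the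
   counting measure on {-1, 1}. *)
definition sphere_measure :: "'a::euclidean_space measure" where
  "sphere_measure =
     scale_measure (of_nat DIM('a)) (distr (restrict_space lborel (ball 0 1 - {0})) borel sgn)"

lemma sets_sphere_measure [simp, measurable_cong]: "sets sphere_measure = sets borel"
  by (simp add: sphere_measure_def)

lemma space_sphere_measure [simp]: "space sphere_measure = UNIV"
  by (simp add: sphere_measure_def space_scale_measure)

lemma emeasure_sphere_measure:
  fixes A :: "'a::euclidean_space set"
  assumes "A \<in> sets borel"
  shows "emeasure sphere_measure A =
           of_nat DIM('a) * emeasure lborel {x \<in> ball 0 1 - {0}. sgn x \<in> A}"
proof -
  have m: "sgn \<in> measurable (restrict_space lborel (ball 0 1 - {0 :: 'a})) borel"
    by (intro measurable_restrict_space1) simp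
  have "sgn -` A \<inter> space (restrict_space lborel (ball 0 1 - {0})) =
          {x \<in> ball 0 1 - {0}. sgn x \<in> A}"
    by (auto simp: space_restrict_space)
  then show ?thesis
    using assms m
    by (simp add: sphere_measure_def emeasure_distr emeasure_restrict_space subset_eq)
qed

lemma emeasure_sphere_measure_sphere:
  "emeasure sphere_measure (sphere 0 1 :: 'a::euclidean_space set) =
     ennreal (DIM('a) * unit_ball_vol (DIM('a)))"
proof -
  have "{x \<in> ball 0 1 - {0}. sgn x \<in> sphere 0 1} = ball 0 1 - {0 :: 'a}"
    by (auto simp: norm_sgn)
  then have "emeasure sphere_measure (sphere 0 1 :: 'a set) =
               of_nat DIM('a) * emeasure lborel (ball 0 1 - {0 :: 'a})"
    by (simp add: emeasure_sphere_measure)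
  also have "emeasure lborel (ball 0 1 - {0 :: 'a}) = emeasure lborel (ball 0 1 :: 'a set)"
    by (intro emeasure_Diff_null_set) auto
  finally show ?thesis
    by (simp add: emeasure_ball ennreal_mult ennreal_of_nat_eq_real_of_nat)
qed

definition sphere_prob :: "'a::euclidean_space set \<Rightarrow> real" where
  "sphere_prob M = 1 / (DIM('a) * unit_ball_vol (DIM('a))) *
     (LINT \<eta> : M \<inter> sphere 0 1 | sphere_measure. 1)"

(* The family \<sigma> lists the singular values of T: the nonnegative square roots of the eigenvalues of
   transpose T ** T, each occurring as often as the dimension of its eigenspace.  No order is
   imposed on the index type. *)
definition singular_values :: "real^'m^'n \<Rightarrow> ('m \<Rightarrow> real) \<Rightarrow> bool" where
  "singular_values T \<sigma> \<longleftrightarrow>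
     (\<forall>i. 0 \<le> \<sigma> i) \<and>
     (\<forall>s\<ge>0. card {i. \<sigma> i = s} = dim {v. (transpose T ** T) *v v = s\<^sup>2 *\<^sub>R v})"

definition diag :: "('m \<Rightarrow> real) \<Rightarrow> real^'m^'m" where
  "diag d = (\<chi> i j. if i = j then d i else 0)"

end

theory Submission
  imports Defs
begin

text \<open>
  Only the cone over the set of directions matters, so \<^term>\<open>F \<delta>\<close> is the fraction of the unit ball
  of \<open>\<real>\<^sup>n\<close> on which \<open>\<parallel>T\<^sup>t x\<parallel>\<^sup>2 \<le> \<delta> \<parallel>x\<parallel>\<^sup>2\<close>. A singular value decomposition and the rotation invariance of
  Lebesgue measure replace \<open>T\<^sup>t x\<close> by \<open>\<Sigma>\<^sub>0 y\<close>, where \<open>x = (y, z)\<close> with \<open>y \<in> \<real>\<^sup>m\<close> and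
  \<open>z \<in> \<real>\<^sup>n\<^sup>-\<^sup>m\<close>. Put \<open>y = s \<Sigma>\<^sub>0\<^sup>-\<^sup>1 \<eta>\<close> with \<open>\<eta>\<close> on the unit sphere and then \<open>s = \<parallel>z\<parallel> r\<close>: with
  \<open>q = \<parallel>\<Sigma>\<^sub>0\<^sup>-\<^sup>1 \<eta>\<parallel>\<^sup>2\<close> the condition becomes \<open>r\<^sup>2 / (1 + q r\<^sup>2) \<le> \<delta>\<close>, and scaling \<open>z\<close> shows that its integral
  is a constant times \<open>(1 + q r\<^sup>2)\<^sup>-\<^sup>n\<^sup>/\<^sup>2\<close>. The substitution \<open>t = r\<^sup>2 / (1 + q r\<^sup>2)\<close> turns
  \<open>r\<^sup>m\<^sup>-\<^sup>1 (1 + q r\<^sup>2)\<^sup>-\<^sup>n\<^sup>/\<^sup>2 dr\<close> into the stated density. The constant is found by taking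
  \<open>\<Sigma>\<^sub>0\<close> to be the identity and \<open>\<delta> = 1\<close>.
\<close>

section \<open>Singular value decomposition\<close>

lemma inner_matrix_vector_mult_left:
  fixes A :: "real^'m^'n"
  shows "(A *v x) \<bullet> y = x \<bullet> (transpose A *v y)"
  by (metis dot_lmul_matrix inner_commute transpose_matrix_vector)

text \<open>The fibres of \<open>\<sigma>\<close> partition the index type, and each has as many
  elements as an orthonormal basis of the matching eigenspace, so these bases can be listed together
  as one family indexed by \<open>'m\<close>. Across eigenspaces, orthogonality comes from the
  symmetry of \<open>transpose T ** T\<close>, since distinct nonnegative numbers have distinct
  squares.\<close>

lemma singular_values_eigenbasis:
  fixes T :: "real^'m^'n"
  assumes "singular_values T \<sigma>"
  obtains v :: "'m \<Rightarrow> real^'m"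
  where "\<And>i j. v i \<bullet> v j = (if i = j then 1 else 0)"
    and "\<And>i. (transpose T ** T) *v v i = (\<sigma> i)\<^sup>2 *\<^sub>R v i"
proof -
  define E where "E s = {w. (transpose T ** T) *v w = s\<^sup>2 *\<^sub>R w}" for s
  have nonneg: "0 \<le> \<sigma> i" for i
    using assms by (simp add: singular_values_def)
  have card_E: "card {i. \<sigma> i = s} = dim (E s)" if "0 \<le> s" for s
    using assms that by (simp add: singular_values_def E_def)
  have "subspace (E s)" for s
    by (auto simp: E_def subspace_def matrix_vector_right_distrib matrix_vector_mult_scaleR
        scaleR_add_right)
  then have "\<exists>B \<subseteq> E s. pairwise orthogonal B \<and> (\<forall>x\<in>B. norm x = 1) \<and> finite B \<and>
      card B = dim (E s)" for s
    by (metis orthonormal_basis_subspace independent_imp_finite)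
  then obtain B where B: "\<And>s. B s \<subseteq> E s" "\<And>s. pairwise orthogonal (B s)"
    "\<And>s x. x \<in> B s \<Longrightarrow> norm x = 1" "\<And>s. finite (B s)" "\<And>s. card (B s) = dim (E s)"
    by metis
  have "\<exists>b. bij_betw b {i. \<sigma> i = s} (B s)" if "0 \<le> s" for s
    using finite_same_card_bij[of "{i. \<sigma> i = s}" "B s"] B card_E[OF that] by simp
  then obtain b where b: "\<And>s. 0 \<le> s \<Longrightarrow> bij_betw (b s) {i. \<sigma> i = s} (B s)"
    by metis
  \<comment> \<open>\<open>b s\<close> enumerates \<open>B s\<close> along the fibre of
    \<open>s\<close>, so the index \<open>i\<close> uses the enumeration that belongs to its own
    value \<open>\<sigma> i\<close>.\<close>
  define v where "v i = b (\<sigma> i) i" for i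
  have vB: "v i \<in> B (\<sigma> i)" for i
    using b[OF nonneg[of i]] by (auto simp: v_def dest: bij_betw_apply)
  have eig: "(transpose T ** T) *v v i = (\<sigma> i)\<^sup>2 *\<^sub>R v i" for i
    using vB[of i] B(1) by (auto simp: E_def)
  have "v i \<bullet> v j = 0" if "i \<noteq> j" for i j
  proof (cases "\<sigma> i = \<sigma> j")
    case True
    then have "v i \<noteq> v j"
      using b[OF nonneg[of i]] that by (auto simp: v_def bij_betw_def inj_on_def)
    then show ?thesis
      using vB[of i] vB[of j] B(2) True by (auto simp: pairwise_def orthogonal_def)
  next
    case False
    have "(\<sigma> i)\<^sup>2 * (v i \<bullet> v j) = ((transpose T ** T) *v v i) \<bullet> v j"
      by (simp add: eig)
    also have "\<dots> = v i \<bullet> ((transpose T ** T) *v v j)"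
      by (simp add: inner_matrix_vector_mult_left matrix_transpose_mul
          del: transpose_matrix_vector)
    also have "\<dots> = (\<sigma> j)\<^sup>2 * (v i \<bullet> v j)"
      by (simp add: eig)
    finally show ?thesis
      using False nonneg[of i] nonneg[of j] by simp
  qed
  moreover have "v i \<bullet> v i = 1" for i
    using B(3)[OF vB[of i]] by (simp add: norm_eq_1)
  ultimately show thesis
    using eig that[of v] by simp
qed

text \<open>Serves to complete the left singular vectors to an orthonormal basis. The orthogonal
  complement of their span has dimension n - m, which is the number of row positions outside
  \<open>range \<phi>\<close>, so an orthonormal basis of it fills the remaining rows
  exactly.\<close>

lemma orthogonal_matrix_rows_extension:
  fixes u :: "'m::finite \<Rightarrow> real^'n" and \<phi> :: "'m \<Rightarrow> 'n"
  assumes u: "\<And>i j. u i \<bullet> u j = (if i = j then 1 else 0)" and \<phi>: "inj \<phi>"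
  obtains P :: "real^'n^'n" where "orthogonal_matrix P" "\<And>i. row (\<phi> i) P = u i"
proof -
  have "inj u"
    using u by (metis injI zero_neq_one)
  have [simp]: "u i \<noteq> 0" for i
    using u[of i i] by auto
  define W where "W = {y. \<forall>x\<in>span (range u). orthogonal x y}"
  have "pairwise orthogonal (range u)"
    using u by (auto simp: pairwise_def orthogonal_def)
  then have "independent (range u)"
    by (rule pairwise_orthogonal_independent) auto
  then have "dim (span (range u)) = CARD('m)"
    using \<open>inj u\<close> by (simp add: dim_eq_card_independent card_image)
  then have "dim W + CARD('m) = CARD('n)"
    using dim_subspace_orthogonal_to_vectors[of "span (range u)" UNIV] by (simp add: W_def)
  then have "dim W = card (UNIV - range \<phi>)"
    using \<phi> by (simp add: card_Diff_subset card_image)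
  moreover obtain B where B: "B \<subseteq> W" "pairwise orthogonal B" "\<And>x. x \<in> B \<Longrightarrow> norm x = 1"
    "independent B" "card B = dim W"
    using orthonormal_basis_subspace[of W]
    by (metis W_def subspace_orthogonal_to_vectors)
  ultimately obtain b where b: "bij_betw b (UNIV - range \<phi>) B"
    by (metis finite_same_card_bij finite independent_imp_finite)
  define r where "r k = (if k \<in> range \<phi> then u (inv \<phi> k) else b k)" for k
  have r_\<phi>: "r (\<phi> i) = u i" for i
    using \<phi> by (simp add: r_def)
  have bB: "b k \<in> B" if "k \<notin> range \<phi>" for k
    using b that by (auto dest: bij_betw_apply)
  have ub: "orthogonal (u i) (b k)" if "k \<notin> range \<phi>" for i k
    using bB[OF that] B(1) by (auto simp: W_def span_base)
  have "norm (r k) = 1" for k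
    using u bB[of k] B(3) by (cases "k \<in> range \<phi>") (auto simp: r_def norm_eq_1)
  moreover have "orthogonal (r k) (r l)" if "k \<noteq> l" for k l
  proof (cases "k \<in> range \<phi>")
    case True
    then obtain i where k: "k = \<phi> i" by auto
    show ?thesis
    proof (cases "l \<in> range \<phi>")
      case True
      then show ?thesis
        using that u by (auto simp: k r_\<phi> orthogonal_def)
    next
      case False
      then show ?thesis
        using ub by (simp add: k r_\<phi> r_def)
    qed
  next
    case False
    show ?thesis
    proof (cases "l \<in> range \<phi>")
      case True
      then show ?thesis
        using ub False by (auto simp: r_\<phi> r_def orthogonal_commute)
    next
      case l: False
      then have "b k \<noteq> b l"
        using b that False by (auto simp: bij_betw_def inj_on_def)
      then show ?thesis
        using False l bB B(2) by (simp add: r_def pairwise_def)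
    qed
  qed
  moreover have row: "row k (\<chi> k. r k) = r k" for k
    by (simp add: row_def vec_eq_iff)
  ultimately have "orthogonal_matrix (\<chi> k. r k)"
    by (simp add: orthogonal_matrix_orthonormal_rows)
  then show thesis
    using that[of "\<chi> k. r k"] r_\<phi> row by simp
qed

text \<open>Full rank makes \<open>T\<close> injective, and the squared length of
  \<open>T *v v i\<close> is \<open>(\<sigma> i)\<^sup>2\<close>, so a zero singular value would
  force the unit vector \<open>v i\<close> to vanish.\<close>

lemma singular_values_pos:
  fixes T :: "real^'m^'n"
  assumes "rank T = CARD('m)" "singular_values T \<sigma>"
  shows "0 < \<sigma> i"
proof -
  obtain v where v: "\<And>i j. v i \<bullet> v j = (if i = j then 1 else 0)"
    "\<And>i. (transpose T ** T) *v v i = (\<sigma> i)\<^sup>2 *\<^sub>R v i"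
    using singular_values_eigenbasis[OF assms(2)] by blast
  have "T *v v i \<noteq> 0"
    using assms(1) v(1)[of i i] full_rank_injective[of T]
    by (metis inj_eq inner_zero_left matrix_vector_mult_0_right zero_neq_one)
  moreover have "(T *v v i) \<bullet> (T *v v i) = (\<sigma> i)\<^sup>2"
    by (simp add: inner_matrix_vector_mult_left matrix_vector_mul_assoc v
        del: transpose_matrix_vector)
  ultimately have "\<sigma> i \<noteq> 0"
    by auto
  moreover have "0 \<le> \<sigma> i"
    using assms(2) by (simp add: singular_values_def)
  ultimately show ?thesis
    by simp
qed

lemma norm_orthogonal_matrix_mult:
  fixes P :: "real^'n^'n"
  assumes "orthogonal_matrix P"
  shows "norm (P *v x) = norm x"
  using assms
  by (simp add: norm_eq inner_matrix_vector_mult_left matrix_vector_mul_assoc orthogonal_matrix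
      del: transpose_matrix_vector)

lemma matrix_vector_mult_row: "(A *v x) $ i = row i A \<bullet> (x :: real^'n)"
  by (simp add: matrix_vector_mult_def row_def inner_vec_def)

text \<open>The matrix \<open>Q\<close> with rows \<open>v i\<close> preserves the length of
  \<open>transpose T *v x\<close>, and the coordinate along \<open>v i\<close> is the inner product
  of \<open>x\<close> with \<open>T *v v i\<close>, which is \<open>\<sigma> i\<close> times the
  left singular vector \<open>u i\<close>. Only this formula for the quadratic form is recorded. The
  injection \<open>\<phi>\<close> says where the m distinguished coordinates sit, since the types
  \<open>'m\<close> and \<open>'n\<close> are not related by any inclusion.\<close>

lemma singular_value_decomposition:
  fixes T :: "real^'m^'n" and \<phi> :: "'m \<Rightarrow> 'n"
  assumes "rank T = CARD('m)" "singular_values T \<sigma>" "inj \<phi>"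
  obtains P :: "real^'n^'n" where "orthogonal_matrix P"
    "\<And>x. (norm (transpose T *v x))\<^sup>2 = (\<Sum>i\<in>UNIV. (\<sigma> i * (P *v x) $ \<phi> i)\<^sup>2)"
proof -
  obtain v where v: "\<And>i j. v i \<bullet> v j = (if i = j then 1 else 0)"
    "\<And>i. (transpose T ** T) *v v i = (\<sigma> i)\<^sup>2 *\<^sub>R v i"
    using singular_values_eigenbasis[OF assms(2)] by blast
  have pos: "0 < \<sigma> i" for i
    by (rule singular_values_pos[OF assms(1,2)])
  define u where "u i = (1 / \<sigma> i) *\<^sub>R (T *v v i)" for i
  have "u i \<bullet> u j = (if i = j then 1 else 0)" for i j
    using pos[of i] pos[of j]
    by (auto simp add: u_def inner_matrix_vector_mult_left matrix_vector_mul_assoc v power2_eq_square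
        simp del: transpose_matrix_vector)
  then obtain P :: "real^'n^'n" where P: "orthogonal_matrix P" "\<And>i. row (\<phi> i) P = u i"
    using orthogonal_matrix_rows_extension[of u \<phi>] assms(3) by blast
  define Q :: "real^'m^'m" where "Q = (\<chi> i. v i)"
  have row_Q: "row i Q = v i" for i
    by (simp add: Q_def row_def vec_eq_iff)
  have "orthogonal_matrix Q"
    by (simp add: orthogonal_matrix_orthonormal_rows row_Q norm_eq_1 orthogonal_def v)
  have "(norm (transpose T *v x))\<^sup>2 = (\<Sum>i\<in>UNIV. (\<sigma> i * (P *v x) $ \<phi> i)\<^sup>2)" for x
  proof -
    have "(norm (transpose T *v x))\<^sup>2 = (norm (Q *v (transpose T *v x)))\<^sup>2"
      using norm_orthogonal_matrix_mult[OF \<open>orthogonal_matrix Q\<close>] by metis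
    also have "\<dots> = (\<Sum>i\<in>UNIV. (v i \<bullet> (transpose T *v x))\<^sup>2)"
      unfolding norm_vec_def L2_set_def
      by (simp add: sum_nonneg matrix_vector_mult_row[of Q] row_Q del: transpose_matrix_vector)
    also have "\<dots> = (\<Sum>i\<in>UNIV. (\<sigma> i * (P *v x) $ \<phi> i)\<^sup>2)"
      using pos by (intro sum.cong refl)
        (simp add: matrix_vector_mult_row P u_def less_imp_neq[symmetric] less_imp_neq[OF pos, symmetric]
          inner_matrix_vector_mult_left del: transpose_matrix_vector)
    finally show ?thesis .
  qed
  then show thesis
    using that P(1) by blast
qed

section \<open>Lebesgue measure and orthogonal maps\<close>

text \<open>The image measure is translation invariant because \<open>f\<close> is linear and onto,
  and it agrees with Lebesgue measure on balls about the origin, whose preimages are the same balls.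
  Invariant measures are proportional, and the unit ball fixes the factor as 1.\<close>

lemma distr_lborel_orthogonal_transformation:
  fixes f :: "'a::euclidean_space \<Rightarrow> 'a"
  assumes f: "orthogonal_transformation f"
  shows "distr lborel borel f = lborel"
proof (rule measure_eqI)
  define \<mu> where "\<mu> = distr lborel borel f"
  have lin: "linear f"
    using f by (rule orthogonal_transformation_linear)
  have [measurable]: "f \<in> borel_measurable borel"
    using lin by (intro borel_measurable_continuous_onI linear_continuous_on)
      (simp add: linear_conv_bounded_linear)
  \<comment> \<open>Translating by \<open>y\<close> after \<open>f\<close> amounts to translating by
    the preimage \<open>g y\<close> before \<open>f\<close>.\<close>
  obtain g where g: "linear g" "\<And>x. f (g x) = x"
    using f orthogonal_transformation_surj[OF f] lin
    by (metis linear_surjective_right_inverse comp_apply id_apply)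
  have f_translate: "distr \<mu> borel (\<lambda>x. y + x) = \<mu>" for y
  proof -
    have "\<mu> = distr (distr lborel borel (\<lambda>x. g y + x)) borel f"
      using lborel_distr_plus[of "g y"] by (simp add: \<mu>_def)
    also have "\<dots> = distr lborel borel (\<lambda>x. y + f x)"
      by (subst distr_distr) (auto simp: o_def linear_add[OF lin] g)
    also have "\<dots> = distr \<mu> borel (\<lambda>x. y + x)"
      by (simp add: \<mu>_def distr_distr o_def)
    finally show ?thesis ..
  qed
  have sets_\<mu> [simp, measurable_cong]: "sets \<mu> = sets borel"
    by (simp add: \<mu>_def)
  have "f -` ball 0 r = ball 0 r" for r
    using orthogonal_transformation_norm[OF f] by auto
  then have \<mu>_ball: "emeasure \<mu> (ball 0 r) = emeasure lborel (ball 0 r :: 'a set)" for r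
    by (simp add: \<mu>_def emeasure_distr)
  \<comment> \<open>Balls of integer radius exhaust the space and have finite measure. The exchanges
    of integrals below rest on this.\<close>
  interpret \<mu>: sigma_finite_measure \<mu>
  proof
    have "x \<in> (\<Union>k. ball 0 (real k))" for x :: 'a
      using reals_Archimedean2[of "norm x"] by auto
    then have "(\<Union>k. ball 0 (real k)) = (UNIV :: 'a set)"
      by blast
    moreover have "space \<mu> = UNIV"
      by (simp add: \<mu>_def)
    ultimately show "\<exists>A. countable A \<and> A \<subseteq> sets \<mu> \<and> \<Union>A = space \<mu> \<and> (\<forall>a\<in>A. emeasure \<mu> a \<noteq> \<infinity>)"
      by (intro exI[of _ "range (\<lambda>k. ball 0 (real k))"]) (auto simp: \<mu>_ball emeasure_ball)
  qed
  interpret pair: pair_sigma_finite \<mu> "lborel :: 'a measure" ..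
  fix A assume "A \<in> sets (distr lborel borel f)"
  then have [measurable]: "A \<in> sets borel" by simp
  let ?B = "ball 0 1 :: 'a set"
  text \<open>The standard uniqueness argument for translation invariant measures.\<close>
  have [measurable]: "?B \<in> sets borel"
    by simp
  have shift: "(\<integral>\<^sup>+y. h y \<partial>lborel) = (\<integral>\<^sup>+y. h (c + y) \<partial>lborel)"
    if [measurable]: "h \<in> borel_measurable borel" for h :: "'a \<Rightarrow> ennreal" and c
    by (subst (1) lborel_distr_plus[of c, symmetric]) (simp add: nn_integral_distr)
  have shift_\<mu>: "(\<integral>\<^sup>+y. h y \<partial>\<mu>) = (\<integral>\<^sup>+y. h (c + y) \<partial>\<mu>)"
    if [measurable]: "h \<in> borel_measurable borel" for h :: "'a \<Rightarrow> ennreal" and c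
    by (subst (1) f_translate[of c, symmetric]) (simp add: nn_integral_distr)
  have "emeasure \<mu> A * emeasure lborel ?B = (\<integral>\<^sup>+x. indicator A x * emeasure lborel ?B \<partial>\<mu>)"
    by (simp add: nn_integral_multc)
  also have "\<dots> = (\<integral>\<^sup>+x. \<integral>\<^sup>+y. indicator A x * indicator ?B (- x + y) \<partial>lborel \<partial>\<mu>)"
  proof (rule nn_integral_cong)
    fix x
    have "indicator A x * emeasure lborel ?B = (indicator A x :: ennreal) * (\<integral>\<^sup>+y. indicator ?B y \<partial>lborel)"
      by simp
    also have "\<dots> = indicator A x * (\<integral>\<^sup>+y. indicator ?B (- x + y) \<partial>lborel)"
      using shift[OF borel_measurable_indicator, of ?B "- x"] by simp
    also have "\<dots> = (\<integral>\<^sup>+y. indicator A x * indicator ?B (- x + y) \<partial>lborel)"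
      by (rule nn_integral_cmult[symmetric]) measurable
    finally show "indicator A x * emeasure lborel ?B =
        (\<integral>\<^sup>+y. indicator A x * indicator ?B (- x + y) \<partial>lborel)" .
  qed
  also have "\<dots> = (\<integral>\<^sup>+y. \<integral>\<^sup>+x. indicator A x * indicator ?B (- x + y) \<partial>\<mu> \<partial>lborel)"
    by (rule pair.Fubini'[symmetric]) measurable
  also have "\<dots> = (\<integral>\<^sup>+y. \<integral>\<^sup>+x. indicator A (y + x) * indicator ?B (- (y + x) + y) \<partial>\<mu> \<partial>lborel)"
    by (intro nn_integral_cong shift_\<mu>) measurable
  \<comment> \<open>Here \<open>- (y + x) + y\<close> is \<open>- x\<close>, and the ball is
    symmetric about the origin.\<close>
  also have "\<dots> = (\<integral>\<^sup>+y. \<integral>\<^sup>+x. indicator A (x + y) * indicator ?B x \<partial>\<mu> \<partial>lborel)"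
    by (intro nn_integral_cong) (auto simp: add.commute indicator_def)
  also have "\<dots> = (\<integral>\<^sup>+x. \<integral>\<^sup>+y. indicator A (x + y) * indicator ?B x \<partial>lborel \<partial>\<mu>)"
    by (rule pair.Fubini') measurable
  also have "\<dots> = (\<integral>\<^sup>+x. \<integral>\<^sup>+y. indicator A y * indicator ?B x \<partial>lborel \<partial>\<mu>)"
    by (intro nn_integral_cong shift[symmetric]) measurable
  also have "\<dots> = (\<integral>\<^sup>+x. emeasure lborel A * indicator ?B x \<partial>\<mu>)"
    by (intro nn_integral_cong) (subst nn_integral_multc, auto)
  also have "\<dots> = emeasure lborel A * emeasure lborel ?B"
    by (subst nn_integral_cmult) (auto simp: \<mu>_ball)
  finally have "emeasure \<mu> A * emeasure lborel ?B / emeasure lborel ?B =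
      emeasure lborel A * emeasure lborel ?B / emeasure lborel ?B"
    by simp
  moreover have "emeasure lborel ?B \<noteq> 0" "emeasure lborel ?B \<noteq> top"
    using unit_ball_vol_pos[of "real DIM('a)"] by (simp_all add: emeasure_ball less_imp_neq[symmetric])
  ultimately show "emeasure (distr lborel borel f) A = emeasure lborel A"
    by (simp add: mult_divide_eq_ennreal \<mu>_def)
qed (simp)

section \<open>Polar coordinates\<close>

lemma nn_integral_lborel_scaleR:
  fixes f :: "'a::euclidean_space \<Rightarrow> ennreal"
  assumes [measurable]: "f \<in> borel_measurable borel" and c: "0 < c"
  shows "(\<integral>\<^sup>+x. f x \<partial>lborel) = ennreal (c ^ DIM('a)) * (\<integral>\<^sup>+x. f (c *\<^sub>R x) \<partial>lborel)"
  using c by (subst lborel_affine[of c 0]) (simp_all add: nn_integral_density nn_integral_distr nn_integral_cmult)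

text \<open>The antiderivative is \<open>- (1 / s ^ n)\<close>. In polar coordinates, with
  \<open>a\<close> the norm of a point, this integral supplies the factor that cancels a power of
  that norm.\<close>

lemma nn_integral_inverse_power:
  assumes "0 < a" "0 < n"
  shows "(\<integral>\<^sup>+s. ennreal (real n / s ^ Suc n) * indicator {a<..} s \<partial>lborel) = ennreal (1 / a ^ n)"
proof -
  \<comment> \<open>The end point is a null set, and the fundamental theorem is applied on the
    closed half-line.\<close>
  have "(\<integral>\<^sup>+s. ennreal (real n / s ^ Suc n) * indicator {a<..} s \<partial>lborel) =
      (\<integral>\<^sup>+s. ennreal (real n / s ^ Suc n) * indicator {a..} s \<partial>lborel)"
    using AE_lborel_singleton[of a]
    by (intro nn_integral_cong_AE, elim eventually_mono) (auto simp: indicator_def)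
  also have "\<dots> = ennreal (0 - (- (1 / a ^ n)))"
  proof (rule nn_integral_FTC_atLeast)
    fix x :: real assume "a \<le> x"
    with assms have x: "0 < x" by simp
    have "x * x ^ (n - Suc 0) = x ^ n"
      using assms by (metis power_Suc Suc_pred)
    then show "((\<lambda>s. - (1 / s ^ n)) has_real_derivative real n / x ^ Suc n) (at x)"
      using x by (auto intro!: derivative_eq_intros simp: field_simps)
    show "0 \<le> real n / x ^ Suc n"
      using x by simp
  next
    have "((\<lambda>s::real. inverse s ^ n) \<longlongrightarrow> 0 ^ n) at_top"
      by (intro tendsto_power tendsto_inverse_0_at_top filterlim_ident)
    then show "((\<lambda>s::real. - (1 / s ^ n)) \<longlongrightarrow> 0) at_top"
      using tendsto_minus[of "\<lambda>s::real. inverse s ^ n" "0 ^ n" at_top] assms(2)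
      by (simp add: power_inverse inverse_eq_divide power_one_over zero_power)
  qed auto
  finally show ?thesis by simp
qed

lemma nn_integral_sphere_measure:
  fixes f :: "'a::euclidean_space \<Rightarrow> ennreal"
  assumes [measurable]: "f \<in> borel_measurable borel"
  shows "(\<integral>\<^sup>+\<eta>. f \<eta> \<partial>sphere_measure) =
    ennreal (DIM('a)) * (\<integral>\<^sup>+x. f (sgn x) * indicator (ball 0 1 - {0}) x \<partial>lborel)"
proof -
  have "sgn \<in> measurable (restrict_space lborel (ball 0 1 - {0 :: 'a})) borel"
    by (intro measurable_restrict_space1) simp
  then show ?thesis
    by (simp add: sphere_measure_def nn_integral_scale_measure nn_integral_distr
        nn_integral_restrict_space ennreal_of_nat_eq_real_of_nat)
qed

text \<open>By definition the spherical integral is n times an integral over the punctured unit ball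
  of values at \<open>sgn x\<close>. There r = norm x * s turns \<open>r *\<^sub>R sgn x\<close>
  into \<open>s *\<^sub>R x\<close>, and after exchanging the integrals y = s x frees
  \<open>f y\<close> from \<open>s\<close>. What remains is the integral of
  \<open>n / s ^ Suc n\<close> over s > norm y, and it cancels the factor
  \<open>norm y ^ n\<close>.\<close>

lemma nn_integral_polar:
  fixes f :: "'a::euclidean_space \<Rightarrow> ennreal"
  assumes [measurable]: "f \<in> borel_measurable borel"
  shows "(\<integral>\<^sup>+x. f x \<partial>lborel) =
    (\<integral>\<^sup>+\<eta>. \<integral>\<^sup>+r. ennreal (r ^ (DIM('a) - 1)) * indicator {0<..} r * f (r *\<^sub>R \<eta>) \<partial>lborel \<partial>sphere_measure)"
proof -
  define n where "n = DIM('a)"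
  have "0 < n"
    by (simp add: n_def)
  then have n: "0 < n" "\<And>x::real. x * x ^ (n - 1) = x ^ n"
    by (auto simp flip: power_Suc)
  let ?I = "indicator {0<..} :: real \<Rightarrow> ennreal"
  let ?B = "indicator (ball 0 1 - {0}) :: 'a \<Rightarrow> ennreal"
  have [measurable]: "ball 0 1 - {0 :: 'a} \<in> sets borel"
    by simp
  \<comment> \<open>Substitution r = norm x * s: the powers of \<open>norm x\<close> from
    \<open>r ^ (n - 1)\<close> and from dr combine to \<open>norm x ^ n\<close>.\<close>
  have radial: "(\<integral>\<^sup>+r. ennreal (r ^ (n - 1)) * ?I r * f (r *\<^sub>R sgn x) \<partial>lborel) =
      (\<integral>\<^sup>+s. ennreal (norm x ^ n) * (ennreal (s ^ (n - 1)) * ?I s) * f (s *\<^sub>R x) \<partial>lborel)"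
    if "x \<noteq> 0" for x :: 'a
  proof -
    have "(\<integral>\<^sup>+r. ennreal (r ^ (n - 1)) * ?I r * f (r *\<^sub>R sgn x) \<partial>lborel) =
        ennreal (norm x) * (\<integral>\<^sup>+s. ennreal ((norm x * s) ^ (n - 1)) * ?I (norm x * s) *
          f ((norm x * s) *\<^sub>R sgn x) \<partial>lborel)"
      using that by (subst nn_integral_real_affine[where c = "norm x" and t = 0]) simp_all
    also have "\<dots> = (\<integral>\<^sup>+s. ennreal (norm x) * (ennreal ((norm x * s) ^ (n - 1)) *
        ?I (norm x * s) * f ((norm x * s) *\<^sub>R sgn x)) \<partial>lborel)"
      by (rule nn_integral_cmult[symmetric]) measurable
    also have "\<dots> = (\<integral>\<^sup>+s. ennreal (norm x ^ n) * (ennreal (s ^ (n - 1)) * ?I s) * f (s *\<^sub>R x) \<partial>lborel)"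
    proof (rule nn_integral_cong)
      fix s :: real
      show "ennreal (norm x) * (ennreal ((norm x * s) ^ (n - 1)) *
          ?I (norm x * s) * f ((norm x * s) *\<^sub>R sgn x)) =
          ennreal (norm x ^ n) * (ennreal (s ^ (n - 1)) * ?I s) * f (s *\<^sub>R x)"
        using that by (cases "0 < s")
          (auto simp: sgn_div_norm power_mult_distrib ennreal_mult n(2)[symmetric] mult_ac
            zero_less_mult_iff indicator_def)
    qed
    finally show ?thesis .
  qed
  \<comment> \<open>Substitution x = y / s: one factor \<open>1 / s ^ n\<close> is the Jacobian, the
    other comes from \<open>norm x ^ n\<close>. The term \<open>?I (s - norm y)\<close> encodes that
    y / s lies in the unit ball.\<close>
  have inner: "(\<integral>\<^sup>+x. ennreal (norm x ^ n) * ?B x * f (s *\<^sub>R x) \<partial>lborel) =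
      (\<integral>\<^sup>+y. ennreal (norm y ^ n / s ^ (2 * n)) * ?I (s - norm y) * f y \<partial>lborel)"
    if "0 < s" for s
  proof -
    have "(\<integral>\<^sup>+x. ennreal (norm x ^ n) * ?B x * f (s *\<^sub>R x) \<partial>lborel) =
      ennreal ((1 / s) ^ n) * (\<integral>\<^sup>+y. ennreal (norm ((1 / s) *\<^sub>R y) ^ n) * ?B ((1 / s) *\<^sub>R y) *
        f (s *\<^sub>R ((1 / s) *\<^sub>R y)) \<partial>lborel)"
      unfolding n_def by (rule nn_integral_lborel_scaleR) (measurable, use that in simp)
    also have "\<dots> = (\<integral>\<^sup>+y. ennreal ((1 / s) ^ n) * (ennreal (norm ((1 / s) *\<^sub>R y) ^ n) *
        ?B ((1 / s) *\<^sub>R y) * f (s *\<^sub>R ((1 / s) *\<^sub>R y))) \<partial>lborel)"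
      by (rule nn_integral_cmult[symmetric]) measurable
    also have "\<dots> = (\<integral>\<^sup>+y. ennreal (norm y ^ n / s ^ (2 * n)) * ?I (s - norm y) * f y \<partial>lborel)"
    proof (rule nn_integral_cong)
      fix y :: 'a
      have "(1 / s) ^ n * norm ((1 / s) *\<^sub>R y) ^ n = norm y ^ n / s ^ (2 * n)"
        using that by (simp add: power_divide mult_2 power_add)
      then have "ennreal ((1 / s) ^ n) * ennreal (norm ((1 / s) *\<^sub>R y) ^ n) =
          ennreal (norm y ^ n / s ^ (2 * n))"
        using that by (metis ennreal_mult norm_ge_zero zero_le_power divide_nonneg_pos zero_le_one)
      moreover have "ennreal (norm y ^ n / s ^ (2 * n)) * ?B ((1 / s) *\<^sub>R y) =
          ennreal (norm y ^ n / s ^ (2 * n)) * ?I (s - norm y)"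
        \<comment> \<open>At y = 0 the two indicators differ, but \<open>norm y ^ n\<close> vanishes
          there because n > 0.\<close>
        using that n(1) by (cases "y = 0") (auto simp: indicator_def)
      moreover have "s *\<^sub>R ((1 / s) *\<^sub>R y) = y"
        using that by simp
      ultimately show "ennreal ((1 / s) ^ n) * (ennreal (norm ((1 / s) *\<^sub>R y) ^ n) *
          ?B ((1 / s) *\<^sub>R y) * f (s *\<^sub>R ((1 / s) *\<^sub>R y))) =
          ennreal (norm y ^ n / s ^ (2 * n)) * ?I (s - norm y) * f y"
        by (metis mult.assoc)
    qed
    finally show ?thesis .
  qed
  have [measurable]: "(\<lambda>\<eta>::'a. \<integral>\<^sup>+r. ennreal (r ^ (n - 1)) * ?I r * f (r *\<^sub>R \<eta>) \<partial>lborel)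
      \<in> borel_measurable borel"
    by measurable
  have "(\<integral>\<^sup>+\<eta>. \<integral>\<^sup>+r. ennreal (r ^ (n - 1)) * ?I r * f (r *\<^sub>R \<eta>) \<partial>lborel \<partial>sphere_measure) =
      ennreal n * (\<integral>\<^sup>+x. (\<integral>\<^sup>+r. ennreal (r ^ (n - 1)) * ?I r * f (r *\<^sub>R sgn x) \<partial>lborel) * ?B x \<partial>lborel)"
    by (subst nn_integral_sphere_measure) (simp_all add: n_def)
  also have "(\<integral>\<^sup>+x. (\<integral>\<^sup>+r. ennreal (r ^ (n - 1)) * ?I r * f (r *\<^sub>R sgn x) \<partial>lborel) * ?B x \<partial>lborel) =
      (\<integral>\<^sup>+x. \<integral>\<^sup>+s. (ennreal (s ^ (n - 1)) * ?I s) * (ennreal (norm x ^ n) * ?B x * f (s *\<^sub>R x))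
        \<partial>lborel \<partial>lborel)"
  proof (rule nn_integral_cong)
    fix x :: 'a
    show "(\<integral>\<^sup>+r. ennreal (r ^ (n - 1)) * ?I r * f (r *\<^sub>R sgn x) \<partial>lborel) * ?B x =
        (\<integral>\<^sup>+s. (ennreal (s ^ (n - 1)) * ?I s) * (ennreal (norm x ^ n) * ?B x * f (s *\<^sub>R x)) \<partial>lborel)"
    proof (cases "x = 0")
      case False
      show ?thesis
        unfolding radial[OF False]
        by (subst nn_integral_multc[symmetric]) (auto intro!: nn_integral_cong simp: mult_ac)
    qed simp
  qed
  also have "\<dots> = (\<integral>\<^sup>+s. \<integral>\<^sup>+x. (ennreal (s ^ (n - 1)) * ?I s) *
      (ennreal (norm x ^ n) * ?B x * f (s *\<^sub>R x)) \<partial>lborel \<partial>lborel)"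
    by (rule lborel_pair.Fubini'[symmetric]) measurable
  also have "\<dots> = (\<integral>\<^sup>+s. \<integral>\<^sup>+y. (ennreal (s ^ (n - 1)) * ?I s) *
      (ennreal (norm y ^ n / s ^ (2 * n)) * ?I (s - norm y) * f y) \<partial>lborel \<partial>lborel)"
  proof (rule nn_integral_cong)
    fix s :: real
    show "(\<integral>\<^sup>+x. (ennreal (s ^ (n - 1)) * ?I s) *
      (ennreal (norm x ^ n) * ?B x * f (s *\<^sub>R x)) \<partial>(lborel :: 'a measure)) =
      (\<integral>\<^sup>+y. (ennreal (s ^ (n - 1)) * ?I s) *
      (ennreal (norm y ^ n / s ^ (2 * n)) * ?I (s - norm y) * f y) \<partial>lborel)"
    proof (cases "0 < s")
      case True
      have "(\<integral>\<^sup>+x. (ennreal (s ^ (n - 1)) * ?I s) *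
          (ennreal (norm x ^ n) * ?B x * f (s *\<^sub>R x)) \<partial>(lborel :: 'a measure)) =
        (ennreal (s ^ (n - 1)) * ?I s) * (\<integral>\<^sup>+x. ennreal (norm x ^ n) * ?B x * f (s *\<^sub>R x) \<partial>lborel)"
        by (rule nn_integral_cmult) measurable
      also have "\<dots> = (\<integral>\<^sup>+y. (ennreal (s ^ (n - 1)) * ?I s) *
          (ennreal (norm y ^ n / s ^ (2 * n)) * ?I (s - norm y) * f y) \<partial>lborel)"
        unfolding inner[OF True] by (rule nn_integral_cmult[symmetric]) measurable
      finally show ?thesis .
    qed simp
  qed
  also have "\<dots> = (\<integral>\<^sup>+y. \<integral>\<^sup>+s. (ennreal (s ^ (n - 1)) * ?I s) *
      (ennreal (norm y ^ n / s ^ (2 * n)) * ?I (s - norm y) * f y) \<partial>lborel \<partial>lborel)"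
    by (rule lborel_pair.Fubini'[symmetric]) measurable
  also have "ennreal n * \<dots> = (\<integral>\<^sup>+y. ennreal n * (\<integral>\<^sup>+s. (ennreal (s ^ (n - 1)) * ?I s) *
      (ennreal (norm y ^ n / s ^ (2 * n)) * ?I (s - norm y) * f y) \<partial>lborel) \<partial>lborel)"
    by (rule nn_integral_cmult[symmetric]) measurable
  also have "\<dots> = (\<integral>\<^sup>+y. f y \<partial>lborel)"
  proof (rule nn_integral_cong_AE)
    show "AE y in lborel. ennreal n * (\<integral>\<^sup>+s. (ennreal (s ^ (n - 1)) * ?I s) *
      (ennreal (norm y ^ n / s ^ (2 * n)) * ?I (s - norm y) * f y) \<partial>lborel) = f y"
      \<comment> \<open>The origin is excluded because \<open>norm y ^ n\<close> and its reciprocal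
        do not cancel there.\<close>
      using AE_lborel_singleton[of "0::'a"]
    proof eventually_elim
      case (elim y)
      have *: "ennreal n * ((ennreal (s ^ (n - 1)) * ?I s) *
          (ennreal (norm y ^ n / s ^ (2 * n)) * ?I (s - norm y) * f y)) =
        (ennreal (norm y ^ n) * f y) * (ennreal (real n / s ^ Suc n) * indicator {norm y<..} s)" for s
      proof (cases "norm y < s")
        case True
        then have s: "0 < s" using norm_ge_zero[of y] by linarith
        have "s ^ (n - 1) * s * s ^ n = s ^ (2 * n)"
          using n by (simp add: mult.commute[of _ s] mult_2 power_add)
        then have "real n * s ^ (n - 1) * (norm y ^ n / s ^ (2 * n)) = norm y ^ n * (real n / s ^ Suc n)"
          using s by (simp add: field_simps)
        then have "ennreal n * ennreal (s ^ (n - 1)) * ennreal (norm y ^ n / s ^ (2 * n)) =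
            ennreal (norm y ^ n) * ennreal (real n / s ^ Suc n)"
          using s by (simp flip: ennreal_mult)
        then show ?thesis
          using s True by (simp add: indicator_def mult_ac)
      qed simp
      have "ennreal n * (\<integral>\<^sup>+s. (ennreal (s ^ (n - 1)) * ?I s) *
          (ennreal (norm y ^ n / s ^ (2 * n)) * ?I (s - norm y) * f y) \<partial>lborel) =
        (ennreal (norm y ^ n) * f y) * (\<integral>\<^sup>+s. ennreal (real n / s ^ Suc n) * indicator {norm y<..} s \<partial>lborel)"
        by (subst nn_integral_cmult[symmetric], measurable) (subst *, rule nn_integral_cmult, measurable)
      also have "\<dots> = ennreal (norm y ^ n) * ennreal (1 / norm y ^ n) * f y"
        using elim n by (subst nn_integral_inverse_power) (auto simp: mult_ac)
      also have "\<dots> = f y"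
        using elim by (simp flip: ennreal_mult)
      finally show ?case .
    qed
  qed
  finally show ?thesis
    by (simp add: n_def)
qed

text \<open>The measure lives on the whole ambient space, so facts that hold for unit vectors enter
  the integrals through this statement.\<close>

lemma AE_sphere_measure_norm: "AE \<eta> in sphere_measure. norm (\<eta> :: 'a::euclidean_space) = 1"
proof (rule AE_I)
  have [measurable]: "{\<eta> :: 'a. norm \<eta> \<noteq> 1} \<in> sets borel"
    by measurable
  show "emeasure sphere_measure {\<eta> :: 'a. norm \<eta> \<noteq> 1} = 0"
    by (subst emeasure_sphere_measure) (auto simp: norm_sgn)
qed auto

lemma emeasure_sphere_measure_UNIV:
  "emeasure sphere_measure (UNIV :: 'a::euclidean_space set) = ennreal (DIM('a) * unit_ball_vol DIM('a))"
proof -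
  have "emeasure sphere_measure (UNIV :: 'a set) = emeasure sphere_measure (sphere 0 1 :: 'a set)"
    by (rule emeasure_eq_AE) (use AE_sphere_measure_norm in auto)
  then show ?thesis
    by (simp add: emeasure_sphere_measure_sphere)
qed

lemma finite_measure_sphere_measure: "finite_measure (sphere_measure :: 'a::euclidean_space measure)"
  by (rule finite_measureI) (simp add: emeasure_sphere_measure_UNIV)

section \<open>Splitting off coordinates\<close>

lemma bij_betw_Basis_vec: "bij_betw (\<lambda>i. axis i 1) UNIV (Basis :: (real^'n) set)"
  by (auto simp: bij_betw_def inj_on_def axis_eq_axis Basis_vec_def)

lemma prod_Basis_vec: "(\<Prod>b\<in>Basis. g b) = (\<Prod>i\<in>UNIV. g (axis i (1::real) :: real^'n))"
  by (rule prod.reindex_bij_betw[OF bij_betw_Basis_vec, symmetric])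

lemma sum_Basis_vec: "(\<Sum>b\<in>Basis. g b) = (\<Sum>i\<in>UNIV. g (axis i (1::real) :: real^'n))"
  by (rule sum.reindex_bij_betw[OF bij_betw_Basis_vec, symmetric])

lemma borel_measurable_vec_nth [measurable]: "(\<lambda>x. x $ i) \<in> borel_measurable (borel :: (real^'n) measure)"
  by (intro borel_measurable_continuous_onI continuous_intros)

lemma borel_measurable_vec_lambda:
  assumes "\<And>i. (\<lambda>x. f x i) \<in> borel_measurable M"
  shows "(\<lambda>x. (\<chi> i. f x i) :: real^'n) \<in> borel_measurable M"
  using assms by (subst borel_measurable_euclidean_space) (auto simp: Basis_vec_def inner_axis)

interpretation lborel_PiM: product_sigma_finite "\<lambda>_. lborel :: real measure" ..

lemma borel_measurable_vec_merge:
  fixes \<phi> :: "'m::finite \<Rightarrow> 'n::finite"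
  shows "(\<lambda>p. (\<chi> k. if k \<in> range \<phi> then fst p $ inv \<phi> k else snd p k) :: real^'n) \<in> borel_measurable
    ((lborel :: (real^'m) measure) \<Otimes>\<^sub>M PiM (- range \<phi>) (\<lambda>_. lborel))"
proof (rule borel_measurable_vec_lambda)
  fix k
  show "(\<lambda>p. if k \<in> range \<phi> then fst p $ inv \<phi> k else snd p k) \<in> borel_measurable
      ((lborel :: (real^'m) measure) \<Otimes>\<^sub>M PiM (- range \<phi>) (\<lambda>_. lborel))"
  proof (cases "k \<in> range \<phi>")
    case False
    then have "(\<lambda>z. z k) \<in> borel_measurable (PiM (- range \<phi>) (\<lambda>_. lborel :: real measure))"
      using measurable_component_singleton[of k "- range \<phi>" "\<lambda>_. lborel :: real measure"] by simp
    from measurable_compose[OF measurable_snd this] show ?thesis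
      using False by simp
  qed simp
qed

text \<open>The n - m remaining coordinates are kept as a product over the index set
  \<open>- range \<phi>\<close>, because n - m is a difference of cardinalities and not itself the
  size of a given type. Lebesgue measure is determined by its values on boxes, and the preimage of a
  box is a box times a product of intervals.\<close>

lemma lborel_vec_split:
  fixes \<phi> :: "'m::finite \<Rightarrow> 'n::finite"
  assumes \<phi>: "inj \<phi>"
  shows "lborel = distr (lborel \<Otimes>\<^sub>M PiM (- range \<phi>) (\<lambda>_. lborel)) borel
    (\<lambda>(y :: real^'m, z). (\<chi> k. if k \<in> range \<phi> then y $ inv \<phi> k else z k) :: real^'n)"
    (is "_ = distr ?M borel ?g")
proof (rule lborel_eqI)
  let ?P = "PiM (- range \<phi>) (\<lambda>_. lborel :: real measure)"
  interpret P: sigma_finite_measure ?P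
    by (rule lborel_PiM.sigma_finite) simp
  have [measurable]: "?g \<in> borel_measurable ?M"
    unfolding case_prod_beta by (rule borel_measurable_vec_merge)
  fix l u :: "real^'n"
  assume "\<And>b. b \<in> Basis \<Longrightarrow> l \<bullet> b \<le> u \<bullet> b"
  then have le: "l $ k \<le> u $ k" for k
    by (metis axis_in_Basis_iff inner_axis inner_real_def mult.right_neutral real_inner_1_right
        Basis_real_def singletonI)
  have "?g -` box l u \<inter> space ?M =
      box (\<chi> i. l $ \<phi> i) (\<chi> i. u $ \<phi> i) \<times> (\<Pi>\<^sub>E k\<in>- range \<phi>. {l $ k<..<u $ k})"
  proof -
    have all_split: "(\<forall>k. Q k) \<longleftrightarrow> (\<forall>i. Q (\<phi> i)) \<and> (\<forall>k\<in>- range \<phi>. Q k)" for Q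
      by (metis ComplI rangeE)
    have "?g (y, z) \<in> box l u \<longleftrightarrow> y \<in> box (\<chi> i. l $ \<phi> i) (\<chi> i. u $ \<phi> i) \<and>
        (\<forall>k\<in>- range \<phi>. z k \<in> {l $ k<..<u $ k})" for y z
      unfolding mem_box_cart by (subst all_split) (simp add: \<phi>)
    then show ?thesis
      by (auto simp: space_pair_measure space_PiM PiE_iff)
  qed
  then have "emeasure (distr ?M borel ?g) (box l u) =
      emeasure lborel (box (\<chi> i. l $ \<phi> i) (\<chi> i. u $ \<phi> i)) *
      emeasure ?P (\<Pi>\<^sub>E k\<in>- range \<phi>. {l $ k<..<u $ k})"
    by (subst emeasure_distr) (auto simp: P.emeasure_pair_measure_Times intro!: sets_PiM_I_finite)
  also have "emeasure ?P (\<Pi>\<^sub>E k\<in>- range \<phi>. {l $ k<..<u $ k}) =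
      ennreal (\<Prod>k\<in>- range \<phi>. u $ k - l $ k)"
    using le by (subst lborel_PiM.emeasure_PiM) (simp_all add: prod_ennreal)
  also have "emeasure lborel (box (\<chi> i. l $ \<phi> i) (\<chi> i. u $ \<phi> i)) =
      ennreal (\<Prod>i\<in>UNIV. u $ \<phi> i - l $ \<phi> i)"
    using le by (subst emeasure_lborel_box) (auto simp: prod_Basis_vec inner_axis, auto simp: Basis_vec_def inner_axis)
  also have "(\<Prod>i\<in>UNIV. u $ \<phi> i - l $ \<phi> i) = (\<Prod>k\<in>range \<phi>. u $ k - l $ k)"
    using \<phi> by (simp add: prod.reindex)
  also have "ennreal (\<Prod>k\<in>range \<phi>. u $ k - l $ k) * ennreal (\<Prod>k\<in>- range \<phi>. u $ k - l $ k) =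
      ennreal ((\<Prod>k\<in>range \<phi>. u $ k - l $ k) * (\<Prod>k\<in>- range \<phi>. u $ k - l $ k))"
    using le by (intro ennreal_mult[symmetric] prod_nonneg) auto
  also have "(\<Prod>k\<in>range \<phi>. u $ k - l $ k) * (\<Prod>k\<in>- range \<phi>. u $ k - l $ k) =
      (\<Prod>k\<in>UNIV. u $ k - l $ k)"
    by (subst prod.union_disjoint[symmetric]) auto
  finally show "emeasure (distr ?M borel ?g) (box l u) = ennreal (\<Prod>b\<in>Basis. (u - l) \<bullet> b)"
    by (simp add: prod_Basis_vec inner_axis)
qed simp

text \<open>The \<open>y\<close>-integral is placed inside so that slices with fixed
  \<open>z\<close> can be evaluated.\<close>

lemma nn_integral_lborel_vec_split:
  fixes \<phi> :: "'m::finite \<Rightarrow> 'n::finite" and f :: "real^'n \<Rightarrow> ennreal"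
  assumes \<phi>: "inj \<phi>" and f [measurable]: "f \<in> borel_measurable borel"
  shows "(\<integral>\<^sup>+x. f x \<partial>lborel) =
    (\<integral>\<^sup>+z. \<integral>\<^sup>+y. f (\<chi> k. if k \<in> range \<phi> then (y :: real^'m) $ inv \<phi> k else z k) \<partial>lborel
       \<partial>PiM (- range \<phi>) (\<lambda>_. lborel))"
proof -
  let ?P = "PiM (- range \<phi>) (\<lambda>_. lborel :: real measure)"
  interpret P: sigma_finite_measure ?P
    by (rule lborel_PiM.sigma_finite) simp
  interpret pair: pair_sigma_finite "lborel :: (real^'m) measure" ?P ..
  have [measurable]: "(\<lambda>p. (\<chi> k. if k \<in> range \<phi> then fst p $ inv \<phi> k else snd p k) :: real^'n)
      \<in> borel_measurable ((lborel :: (real^'m) measure) \<Otimes>\<^sub>M ?P)"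
    by (rule borel_measurable_vec_merge)
  show ?thesis
    by (subst lborel_vec_split[OF \<phi>], subst nn_integral_distr)
      (auto simp: case_prod_beta pair.nn_integral_snd[symmetric] cong: if_cong)
qed

text \<open>Each coordinate contributes one factor \<open>c\<close>, by induction on
  \<open>J\<close>. The scaled point is a restricted function because points of the product space
  are \<open>undefined\<close> outside \<open>J\<close>.\<close>

lemma nn_integral_PiM_lborel_scale:
  fixes g :: "('i \<Rightarrow> real) \<Rightarrow> ennreal"
  assumes "finite J" "0 < c" "g \<in> borel_measurable (PiM J (\<lambda>_. lborel))"
  shows "(\<integral>\<^sup>+z. g z \<partial>PiM J (\<lambda>_. lborel)) =
    ennreal (c ^ card J) * (\<integral>\<^sup>+z. g (\<lambda>j\<in>J. c * z j) \<partial>PiM J (\<lambda>_. lborel))"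
  using assms(1,3)
proof (induction J arbitrary: g)
  case empty
  then show ?case
    by (simp add: PiM_empty nn_integral_count_space_finite restrict_def)
next
  case (insert i J)
  note [measurable] = insert.prems
  let ?P = "\<lambda>J. PiM J (\<lambda>_. lborel :: real measure)"
  have restrict_upd: "(\<lambda>j\<in>insert i J. c * (z(i := x)) j) = (\<lambda>j\<in>J. c * z j)(i := c * x)" for z x
    using insert.hyps by (auto simp: fun_eq_iff)
  interpret P: sigma_finite_measure "?P J"
    by (rule lborel_PiM.sigma_finite) fact
  have upd: "(\<lambda>(z, x). z(i := x)) \<in> measurable (?P J \<Otimes>\<^sub>M lborel) (?P (insert i J))"
    by (rule measurable_add_dim)
  have [measurable]: "(\<lambda>p. g ((fst p)(i := snd p))) \<in> borel_measurable (?P J \<Otimes>\<^sub>M borel)"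
    using measurable_compose[OF upd insert.prems] by (simp add: case_prod_beta)
  have g1: "(\<lambda>x. g (z(i := x))) \<in> borel_measurable borel" if "z \<in> space (?P J)" for z
  proof -
    have "(\<lambda>x. (z, x)) \<in> measurable borel (?P J \<Otimes>\<^sub>M borel)"
      using that by simp
    from measurable_compose[OF this, of "\<lambda>p. g ((fst p)(i := snd p))"] show ?thesis
      by simp
  qed
  have [measurable]: "(\<lambda>z. \<lambda>j\<in>J. c * z j) \<in> measurable (?P J) (?P J)"
    by measurable
  have "(\<integral>\<^sup>+z. g z \<partial>?P (insert i J)) = (\<integral>\<^sup>+z. \<integral>\<^sup>+x. g (z(i := x)) \<partial>lborel \<partial>?P J)"
    using insert by (intro lborel_PiM.product_nn_integral_insert) auto
  \<comment> \<open>The induction hypothesis is applied to the function of \<open>z\<close> obtained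
    by integrating out the coordinate \<open>i\<close>. This is why \<open>g\<close> is arbitrary in
    the induction.\<close>
  also have "\<dots> = ennreal (c ^ card J) * (\<integral>\<^sup>+z. \<integral>\<^sup>+x. g ((\<lambda>j\<in>J. c * z j)(i := x)) \<partial>lborel \<partial>?P J)"
    by (rule insert.IH) measurable
  also have "(\<integral>\<^sup>+z. \<integral>\<^sup>+x. g ((\<lambda>j\<in>J. c * z j)(i := x)) \<partial>lborel \<partial>?P J) =
      (\<integral>\<^sup>+z. ennreal c * (\<integral>\<^sup>+x. g (\<lambda>j\<in>insert i J. c * (z(i := x)) j) \<partial>lborel) \<partial>?P J)"
  proof (rule nn_integral_cong)
    fix z assume "z \<in> space (?P J)"
    then have "(\<lambda>j\<in>J. c * z j) \<in> space (?P J)"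
      by (simp add: space_PiM)
    then show "(\<integral>\<^sup>+x. g ((\<lambda>j\<in>J. c * z j)(i := x)) \<partial>lborel) =
        ennreal c * (\<integral>\<^sup>+x. g (\<lambda>j\<in>insert i J. c * (z(i := x)) j) \<partial>lborel)"
      unfolding restrict_upd using assms(2) g1
      by (subst nn_integral_real_affine[where c = c and t = 0]) auto
  qed
  also have "\<dots> = ennreal c * (\<integral>\<^sup>+z. \<integral>\<^sup>+x. g (\<lambda>j\<in>insert i J. c * (z(i := x)) j) \<partial>lborel \<partial>?P J)"
    unfolding restrict_upd by (rule nn_integral_cmult) measurable
  also have "(\<integral>\<^sup>+z. \<integral>\<^sup>+x. g (\<lambda>j\<in>insert i J. c * (z(i := x)) j) \<partial>lborel \<partial>?P J) =
      (\<integral>\<^sup>+z. g (\<lambda>j\<in>insert i J. c * z j) \<partial>?P (insert i J))"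
    using insert by (intro lborel_PiM.product_nn_integral_insert[symmetric]) auto
  also have "ennreal (c ^ card J) * (ennreal c * \<dots>) = ennreal (c ^ card (insert i J)) * \<dots>"
    using assms(2) insert.hyps by (simp add: ennreal_mult mult_ac)
  finally show ?case .
qed

lemma nn_integral_lborel_diag:
  fixes f :: "real^'m \<Rightarrow> ennreal" and c :: "'m \<Rightarrow> real"
  assumes [measurable]: "f \<in> borel_measurable borel" and c: "\<And>i. 0 < c i"
  shows "(\<integral>\<^sup>+y. f y \<partial>lborel) = ennreal (\<Prod>i\<in>UNIV. c i) * (\<integral>\<^sup>+w. f (\<chi> i. c i * w $ i) \<partial>lborel)"
proof -
  \<comment> \<open>The affine change of variables takes its stretching factors indexed by basis
    vectors, and \<open>d\<close> reads \<open>c i\<close> off the vector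
    \<open>axis i 1\<close>.\<close>
  define d where "d b = b \<bullet> (\<chi> i. c i)" for b :: "real^'m"
  have d: "d (axis i 1) = c i" for i
    by (simp add: d_def inner_axis')
  have *: "0 + (\<Sum>j\<in>Basis. (d j * (w \<bullet> j)) *\<^sub>R j) = (\<chi> i. c i * w $ i)" for w
    unfolding sum_Basis_vec d inner_axis
    by (simp add: vec_eq_iff axis_def if_distrib[of "(*) _"] cong: if_cong)
  have "d j \<noteq> 0" if "j \<in> Basis" for j
    using that c d by (auto simp: Basis_vec_def less_imp_neq[OF c, symmetric])
  then have "lborel = density (distr lborel borel (\<lambda>w. \<chi> i. c i * w $ i)) (\<lambda>_. \<Prod>j\<in>Basis. \<bar>d j\<bar>)"
    using lborel_affine_euclidean[of d 0] unfolding * by blast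
  moreover have "(\<Prod>j\<in>Basis. \<bar>d j\<bar>) = (\<Prod>i\<in>UNIV. c i)"
    unfolding prod_Basis_vec d using c by (simp add: less_imp_le)
  ultimately have eq: "lborel = density (distr lborel borel (\<lambda>w. \<chi> i. c i * w $ i)) (\<lambda>_. \<Prod>i\<in>UNIV. c i)"
    by simp
  have [measurable]: "(\<lambda>w::real^'m. \<chi> i. c i * w $ i) \<in> borel_measurable borel"
    by (intro borel_measurable_vec_lambda) measurable
  show ?thesis
    by (subst eq) (simp add: nn_integral_density nn_integral_distr nn_integral_cmult)
qed

text \<open>The exceptional set is a product with one side \<open>{0}\<close>, and this zero factor
  absorbs the infinite lengths of the other sides.\<close>

lemma AE_PiM_lborel_component_nonzero:
  assumes "finite J" "j \<in> J"
  shows "AE z in PiM J (\<lambda>_. lborel :: real measure). z j \<noteq> 0"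
proof (rule AE_I)
  let ?A = "\<Pi>\<^sub>E i\<in>J. if i = j then {0} else (UNIV :: real set)"
  show "{z \<in> space (PiM J (\<lambda>_. lborel)). \<not> z j \<noteq> 0} \<subseteq> ?A"
    by (auto simp: space_PiM PiE_iff extensional_def)
  show "?A \<in> sets (PiM J (\<lambda>_. lborel))"
    using assms by (intro sets_PiM_I_finite) auto
  show "emeasure (PiM J (\<lambda>_. lborel :: real measure)) ?A = 0"
    using assms by (subst lborel_PiM.emeasure_PiM) (auto intro!: prod_zero bexI[of _ j])
qed

lemma borel_measurable_L2_set_PiM:
  "(\<lambda>z. L2_set z J) \<in> borel_measurable (PiM J (\<lambda>_. lborel :: real measure))"
  unfolding L2_set_def
proof (intro measurable_compose[OF _ borel_measurable_sqrt] borel_measurable_sum borel_measurable_power)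
  show "(\<lambda>z. z j) \<in> borel_measurable (PiM J (\<lambda>_. lborel :: real measure))" if "j \<in> J" for j
    using measurable_component_singleton[OF that, of "\<lambda>_. lborel :: real measure"] by simp
qed

text \<open>Replacing z by z / c yields \<open>card J\<close> factors from the Jacobian and
  \<open>m\<close> factors from homogeneity. In the volume computation \<open>card J + m\<close> is
  n and \<open>c\<close> is \<open>sqrt (1 + q \<eta> * r\<^sup>2)\<close>, which produces the
  exponent -n/2.\<close>

lemma nn_integral_L2_set_scale:
  fixes c :: real
  assumes "finite J" "0 < c"
  shows "(\<integral>\<^sup>+z. ennreal (L2_set z J ^ m) * indicator {..<1} (c * L2_set z J) \<partial>PiM J (\<lambda>_. lborel)) =
    ennreal ((1 / c) ^ (card J + m)) *
    (\<integral>\<^sup>+z. ennreal (L2_set z J ^ m) * indicator {..<1} (L2_set z J) \<partial>PiM J (\<lambda>_. lborel))"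
    (is "(\<integral>\<^sup>+z. _ \<partial>?P) = _")
proof -
  note borel_measurable_L2_set_PiM [measurable]
  have L2: "L2_set (\<lambda>j\<in>J. (1 / c) * z j) J = (1 / c) * L2_set z J" for z
  proof -
    have "L2_set (\<lambda>j\<in>J. (1 / c) * z j) J = L2_set (\<lambda>j. (1 / c) * z j) J"
      by (rule L2_set_cong) auto
    also have "\<dots> = (1 / c) * L2_set z J"
      using assms by (subst L2_set_right_distrib) auto
    finally show ?thesis .
  qed
  have "(\<integral>\<^sup>+z. ennreal (L2_set z J ^ m) * indicator {..<1} (c * L2_set z J) \<partial>?P) =
    ennreal ((1 / c) ^ card J) *
    (\<integral>\<^sup>+z. ennreal (((1 / c) * L2_set z J) ^ m) * indicator {..<1} (c * ((1 / c) * L2_set z J)) \<partial>?P)"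
    using assms by (subst nn_integral_PiM_lborel_scale[of J "1 / c"]) (simp_all only: L2, simp_all)
  also have "(\<integral>\<^sup>+z. ennreal (((1 / c) * L2_set z J) ^ m) * indicator {..<1} (c * ((1 / c) * L2_set z J)) \<partial>?P) =
      (\<integral>\<^sup>+z. ennreal ((1 / c) ^ m) * (ennreal (L2_set z J ^ m) * indicator {..<1} (L2_set z J)) \<partial>?P)"
    using assms by (intro nn_integral_cong)
      (simp add: power_divide ennreal_mult[symmetric] mult.assoc[symmetric] L2_set_nonneg)
  also have "\<dots> = ennreal ((1 / c) ^ m) *
      (\<integral>\<^sup>+z. ennreal (L2_set z J ^ m) * indicator {..<1} (L2_set z J) \<partial>?P)"
    by (rule nn_integral_cmult) measurable
  finally show ?thesis
    using assms by (simp add: power_add ennreal_mult mult.assoc)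
qed

section \<open>The radial substitution\<close>

text \<open>With w = 1 + q r^2 the substitution t = r^2 / w has dt = 2 r / w^2 dr and 1 - q t = 1 /
  w, so it remains to collect the exponents of r and w, and the 2 cancels the factor 1/2. As r runs
  through the half-line, t stays below 1 / q, and from there on the truncation by \<open>max\<close>
  makes the right-hand integrand zero.\<close>

lemma nn_integral_radial_substitution:
  fixes a b q \<delta> :: real
  assumes q: "0 < q"
  shows "(\<integral>\<^sup>+r. ennreal (r powr (2 * a - 1) * (1 + q * r\<^sup>2) powr (- (a + b))) * indicator {0<..} r *
      indicator {..\<delta>} (r\<^sup>2 / (1 + q * r\<^sup>2)) \<partial>lborel) =
    (\<integral>\<^sup>+t. ennreal (t powr (a - 1) * (max 0 (1 - t * q)) powr (b - 1) / 2) * indicator {0<..\<delta>} t \<partial>lborel)"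
proof -
  define f where "f t = t powr (a - 1) * (max 0 (1 - t * q)) powr (b - 1) / 2 * indicator {0<..\<delta>} t"
    for t :: real
  define g where "g r = r\<^sup>2 / (1 + q * r\<^sup>2)" for r
  define g' where "g' r = 2 * r / (1 + q * r\<^sup>2)\<^sup>2" for r
  have pos: "0 < 1 + q * r\<^sup>2" for r
    using q by (simp add: add_pos_nonneg)
  have [measurable]: "f \<in> borel_measurable borel" "g \<in> borel_measurable borel"
      "g' \<in> borel_measurable borel"
    by (auto simp: f_def[abs_def] g_def[abs_def] g'_def[abs_def])
  \<comment> \<open>The end points count as zeros for every exponent: t = 0 is cut off by the
    indicator, and at t = 1 / q the value of \<open>0 powr x\<close> is 0 even for x = 0.\<close>
  have f_0: "f t = 0" if "t \<le> 0 \<or> 1 \<le> t * q" for t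
    using that by (auto simp: f_def)
  have g_mono: "g r \<le> g s" if "0 \<le> r" "r \<le> s" for r s
  proof -
    have "r\<^sup>2 * (1 + q * s\<^sup>2) \<le> s\<^sup>2 * (1 + q * r\<^sup>2)"
      using power_mono[OF that(2,1), of 2] by (simp add: algebra_simps)
    then show ?thesis
      using pos by (simp add: g_def divide_simps mult.commute)
  qed
  \<comment> \<open>The substitution rule is for compact intervals, so it is applied on [0, k]. Both
    sides then converge monotonically as k grows.\<close>
  have subst: "(\<integral>\<^sup>+t. f t * indicator {0..g (real k)} t \<partial>lborel) =
      (\<integral>\<^sup>+r. f (g r) * g' r * indicator {0..real k} r \<partial>lborel)" for k
  proof -
    have "(\<integral>\<^sup>+t. f t * indicator {g 0..g (real k)} t \<partial>lborel) =
        (\<integral>\<^sup>+r. f (g r) * g' r * indicator {0..real k} r \<partial>lborel)"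
    proof (rule nn_integral_substitution)
      show "(g has_real_derivative g' r) (at r)" for r
        unfolding g_def g'_def using pos[of r]
        by (auto intro!: derivative_eq_intros simp: field_simps power2_eq_square)
      show "continuous_on {0..real k} g'"
        unfolding g'_def using pos by (intro continuous_intros) (auto simp: less_imp_neq[symmetric])
    qed (auto simp: g'_def set_borel_measurable_def)
    then show ?thesis
      by (simp add: g_def)
  qed
  have lim1: "(\<lambda>k. \<integral>\<^sup>+t. f t * indicator {0..g (real k)} t \<partial>lborel) \<longlonglongrightarrow> (\<integral>\<^sup>+t. f t \<partial>lborel)"
  proof (rule nn_integral_LIMSEQ)
    show "incseq (\<lambda>k t. ennreal (f t * indicator {0..g (real k)} t))"
    proof (intro monoI le_funI ennreal_leI mult_left_mono)
      fix k l :: nat and t assume "k \<le> l"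
      then have "g (real k) \<le> g (real l)"
        by (intro g_mono) auto
      then show "indicator {0..g (real k)} t \<le> (indicator {0..g (real l)} t :: real)"
        by (auto simp: indicator_def)
    qed (simp add: f_def)
    fix t
    show "(\<lambda>k. ennreal (f t * indicator {0..g (real k)} t)) \<longlonglongrightarrow> ennreal (f t)"
    proof (cases "t \<le> 0 \<or> 1 \<le> t * q")
      case True
      then show ?thesis by (simp add: f_0)
    next
      case False
      then have t: "0 < t" "t * q < 1" by auto
      \<comment> \<open>Solving \<open>g r = t\<close> gives
        \<open>r\<^sup>2 = t / (1 - t * q)\<close>. For k >= 1 it is enough that k itself is at
        least this value, because then k <= k^2.\<close>
      have "\<forall>\<^sub>F k in sequentially. t / (1 - t * q) \<le> real k"
        using filterlim_real_sequentially by (simp add: filterlim_at_top)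
      moreover have "\<forall>\<^sub>F k in sequentially. 1 \<le> k"
        by (rule eventually_ge_at_top)
      ultimately have "\<forall>\<^sub>F k in sequentially. t \<le> g (real k)"
      proof eventually_elim
        case (elim k)
        then have "real k \<le> (real k)\<^sup>2"
          by (simp add: power2_eq_square)
        then have "t / (1 - t * q) \<le> (real k)\<^sup>2"
          using elim by linarith
        then have "t \<le> (real k)\<^sup>2 * (1 - t * q)"
          using t by (simp add: divide_simps)
        then have "t * (1 + q * (real k)\<^sup>2) \<le> (real k)\<^sup>2"
          by (simp add: algebra_simps)
        then show ?case
          using pos[of "real k"] by (simp add: g_def pos_le_divide_eq)
      qed
      then have "\<forall>\<^sub>F k in sequentially. ennreal (f t * indicator {0..g (real k)} t) = ennreal (f t)"
        by eventually_elim (use t in \<open>simp add: indicator_def\<close>)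
      then show ?thesis
        by (rule tendsto_eventually)
    qed
  qed measurable
  have lim2: "(\<lambda>k. \<integral>\<^sup>+r. f (g r) * g' r * indicator {0..real k} r \<partial>lborel) \<longlonglongrightarrow>
      (\<integral>\<^sup>+r. f (g r) * g' r * indicator {0..} r \<partial>lborel)"
  proof (rule nn_integral_LIMSEQ)
    show "incseq (\<lambda>k r. ennreal (f (g r) * g' r * indicator {0..real k} r))"
      by (intro monoI le_funI ennreal_leI)
        (auto simp: indicator_def f_def g'_def intro!: mult_nonneg_nonneg)
    fix r
    show "(\<lambda>k. ennreal (f (g r) * g' r * indicator {0..real k} r)) \<longlonglongrightarrow>
        ennreal (f (g r) * g' r * indicator {0..} r)"
    proof (rule tendsto_eventually)
      have "\<forall>\<^sub>F k in sequentially. r \<le> real k"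
        using filterlim_real_sequentially by (simp add: filterlim_at_top)
      then show "\<forall>\<^sub>F k in sequentially. ennreal (f (g r) * g' r * indicator {0..real k} r) =
          ennreal (f (g r) * g' r * indicator {0..} r)"
        by eventually_elim (auto simp: indicator_def)
    qed
  qed measurable
  have "(\<integral>\<^sup>+t. f t \<partial>lborel) = (\<integral>\<^sup>+r. f (g r) * g' r * indicator {0..} r \<partial>lborel)"
    using LIMSEQ_unique[OF lim1[unfolded subst] lim2] .
  also have "\<dots> = (\<integral>\<^sup>+r. ennreal (r powr (2 * a - 1) * (1 + q * r\<^sup>2) powr (- (a + b))) *
      indicator {0<..} r * indicator {..\<delta>} (r\<^sup>2 / (1 + q * r\<^sup>2)) \<partial>lborel)"
  proof (rule nn_integral_cong)
    fix r :: real
    show "ennreal (f (g r) * g' r * indicator {0..} r) =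
        ennreal (r powr (2 * a - 1) * (1 + q * r\<^sup>2) powr (- (a + b))) *
        indicator {0<..} r * indicator {..\<delta>} (r\<^sup>2 / (1 + q * r\<^sup>2))"
    proof (cases "0 < r")
      case True
      define w where "w = 1 + q * r\<^sup>2"
      have w: "0 < w" using pos by (simp add: w_def)
      have g: "g r = r powr 2 * w powr (-1)" "g' r = 2 * (r powr 1 * w powr (-2))"
        using True w by (simp_all add: g_def g'_def w_def[symmetric] powr_minus_divide)
      have "1 - g r * q = w powr (-1)"
        using w by (simp add: g_def w_def[symmetric] powr_minus_divide field_simps)
      then have "g r powr (a - 1) * max 0 (1 - g r * q) powr (b - 1) / 2 * g' r =
          (r powr (2 * (a - 1)) * r powr 1) *
          (w powr (- (a - 1)) * w powr (- (b - 1)) * w powr (-2))"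
      proof -
        assume 1: "1 - g r * q = w powr (-1)"
        have "g r powr (a - 1) = r powr (2 * (a - 1)) * w powr (- (a - 1))"
          unfolding g(1) using True w by (subst powr_mult) (simp_all only: powr_powr powr_ge_zero mult_minus1)
        moreover have "(max 0 (1 - g r * q)) powr (b - 1) = w powr (- (b - 1))"
          unfolding 1 by (subst max_absorb2) (simp_all only: powr_powr powr_ge_zero mult_minus1)
        ultimately show ?thesis
          by (simp add: g(2))
      qed
      also have "\<dots> = r powr (2 * a - 1) * w powr (- (a + b))"
        by (simp only: powr_add[symmetric]) (simp add: algebra_simps)
      finally have "g r powr (a - 1) * max 0 (1 - g r * q) powr (b - 1) / 2 * g' r =
          r powr (2 * a - 1) * w powr (- (a + b))" .
      moreover have "0 < g r"
        using True w by (simp add: g_def w_def[symmetric])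
      moreover have "r\<^sup>2 / w = g r"
        by (simp add: g_def w_def)
      ultimately show ?thesis
        using True by (simp add: f_def w_def[symmetric] indicator_def)
    next
      \<comment> \<open>The half-lines of the two integrands differ only at r = 0, where
        \<open>g r\<close> is 0 and hence \<open>f (g r)\<close> vanishes.\<close>
      case False
      then show ?thesis
        by (cases "r = 0") (auto simp: g_def f_0)
    qed
  qed
  also have "(\<integral>\<^sup>+t. f t \<partial>lborel) =
    (\<integral>\<^sup>+t. ennreal (t powr (a - 1) * (max 0 (1 - t * q)) powr (b - 1) / 2) * indicator {0<..\<delta>} t \<partial>lborel)"
    by (intro nn_integral_cong) (auto simp: f_def indicator_def)
  finally show ?thesis
    by (rule sym)
qed

section \<open>The volume of a cone\<close>

text \<open>The case a = m/2, b = (n - m)/2, a + b = n/2 of the substitution, restated for the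
  integer powers that polar coordinates and the scaling of \<open>z\<close> produce.\<close>

lemma nn_integral_radial_substitution_power:
  fixes q \<delta> :: real and m n :: nat
  assumes q: "0 < q" and mn: "0 < m" "m < n"
  shows "(\<integral>\<^sup>+r. ennreal (r ^ (m - 1)) * indicator {0<..} r * indicator {..\<delta>} (r\<^sup>2 / (1 + q * r\<^sup>2)) *
      ennreal ((1 / sqrt (1 + q * r\<^sup>2)) ^ n) \<partial>lborel) =
    (\<integral>\<^sup>+t. ennreal (t powr (m / 2 - 1) * (max 0 (1 - t * q)) powr ((real n - real m) / 2 - 1) / 2) *
      indicator {0<..\<delta>} t \<partial>lborel)"
proof -
  have "ennreal (r ^ (m - 1)) * indicator {0<..} r * indicator {..\<delta>} (r\<^sup>2 / (1 + q * r\<^sup>2)) *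
      ennreal ((1 / sqrt (1 + q * r\<^sup>2)) ^ n) =
    ennreal (r powr (2 * (real m / 2) - 1) * (1 + q * r\<^sup>2) powr (- (real m / 2 + (real n - real m) / 2))) *
      indicator {0<..} r * indicator {..\<delta>} (r\<^sup>2 / (1 + q * r\<^sup>2))" for r
  proof (cases "0 < r")
    case True
    define w where "w = 1 + q * r\<^sup>2"
    have w: "0 < w"
      using q by (simp add: w_def add_pos_nonneg)
    have "r ^ (m - 1) = r powr (2 * (real m / 2) - 1)"
      using powr_realpow[OF True, of "m - 1"] mn by (simp add: of_nat_diff)
    moreover have "(1 / sqrt w) ^ n = w powr (- (real m / 2 + (real n - real m) / 2))"
    proof -
      have "1 / sqrt w = w powr (- (1 / 2))"
        using w by (simp add: powr_minus_divide powr_half_sqrt)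
      then have "(1 / sqrt w) ^ n = (w powr (- (1 / 2))) powr real n"
        using w by (simp add: powr_realpow)
      then show ?thesis
        by (simp add: powr_powr field_simps)
    qed
    ultimately show ?thesis
      using True by (simp add: w_def[symmetric] ennreal_mult mult_ac)
  qed simp
  then show ?thesis
    using nn_integral_radial_substitution[OF q, of "real m / 2" "(real n - real m) / 2" \<delta>] by simp
qed

text \<open>The point of the product form is that its first factor does not depend on
  \<open>\<sigma>\<close> or \<open>\<delta>\<close>, so a single known case determines it.\<close>

lemma emeasure_cone:
  fixes \<sigma> :: "'m::finite \<Rightarrow> real" and \<phi> :: "'m \<Rightarrow> 'n::finite" and \<delta> :: real
  defines "J \<equiv> - range \<phi>" and "m \<equiv> CARD('m)" and "n \<equiv> CARD('n)"
  assumes \<phi>: "inj \<phi>" and mn: "m < n" and \<sigma>: "\<And>i. 0 < \<sigma> i"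
  shows "emeasure lborel {x :: real^'n. norm x < 1 \<and> (\<Sum>i\<in>UNIV. (\<sigma> i * x $ \<phi> i)\<^sup>2) \<le> \<delta> * (norm x)\<^sup>2} =
    (\<integral>\<^sup>+z. ennreal (L2_set z J ^ m) * indicator {..<1} (L2_set z J) \<partial>PiM J (\<lambda>_. lborel)) *
    (ennreal (1 / (\<Prod>i\<in>UNIV. \<sigma> i)) * (\<integral>\<^sup>+\<eta>. \<integral>\<^sup>+t.
      ennreal (t powr (m / 2 - 1) *
        (max 0 (1 - t * (\<Sum>i\<in>UNIV. ((\<eta> :: real^'m) $ i / \<sigma> i)\<^sup>2))) powr ((real n - real m) / 2 - 1) / 2) *
      indicator {0<..\<delta>} t \<partial>lborel \<partial>sphere_measure))"
proof -
  let ?P = "PiM J (\<lambda>_. lborel :: real measure)"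
  let ?S = "sphere_measure :: (real^'m) measure"
  define \<rho> where "\<rho> z = L2_set z J" for z :: "'n \<Rightarrow> real"
  define q where "q \<eta> = (\<Sum>i\<in>UNIV. (\<eta> $ i / \<sigma> i)\<^sup>2)" for \<eta> :: "real^'m"
  have m: "0 < m" by (simp add: m_def)
  have finJ: "finite J" by simp
  have cardJ: "card J + m = n"
    using \<phi> mn by (simp add: J_def Compl_eq_Diff_UNIV card_Diff_subset card_image m_def n_def)
  \<comment> \<open>Since m < n, \<open>z\<close> has at least one coordinate, and therefore
    positive length almost everywhere.\<close>
  then obtain j where j: "j \<in> J"
    using mn by (metis add_0 all_not_in_conv card.empty less_irrefl)
  have \<rho>_nonneg: "0 \<le> \<rho> z" for z
    by (simp add: \<rho>_def L2_set_nonneg)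
  have \<rho>_sq: "(\<rho> z)\<^sup>2 = (\<Sum>j\<in>J. (z j)\<^sup>2)" for z
    by (simp add: \<rho>_def L2_set_def sum_nonneg)
  have q_nonneg: "0 \<le> q \<eta>" for \<eta>
    by (simp add: q_def sum_nonneg)
  have q_pos: "0 < q \<eta>" if "norm \<eta> = 1" for \<eta>
  proof -
    have "\<eta> \<noteq> 0"
      using that by auto
    then obtain i where i: "\<eta> $ i \<noteq> 0"
      by (auto simp: vec_eq_iff)
    have "0 < (\<eta> $ i / \<sigma> i)\<^sup>2"
      using i \<sigma>[of i] by simp
    also have "\<dots> \<le> q \<eta>"
      unfolding q_def by (rule member_le_sum) auto
    finally show ?thesis .
  qed
  have norm_sq: "(norm y)\<^sup>2 = (\<Sum>i\<in>UNIV. (y $ i)\<^sup>2)" for y :: "real^'k"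
    by (simp add: norm_vec_def L2_set_def sum_nonneg)
  interpret P: sigma_finite_measure ?P
    by (rule lborel_PiM.sigma_finite) fact
  interpret S: finite_measure ?S
    by (rule finite_measure_sphere_measure)
  interpret PL: pair_sigma_finite "lborel :: real measure" ?P ..
  interpret PS: pair_sigma_finite ?S ?P ..
  have [measurable]: "\<rho> \<in> borel_measurable ?P"
    unfolding \<rho>_def[abs_def] by (rule borel_measurable_L2_set_PiM)
  have [measurable]: "q \<in> borel_measurable borel"
    unfolding q_def[abs_def] by measurable
  let ?U = "{x :: real^'n. norm x < 1 \<and> (\<Sum>i\<in>UNIV. (\<sigma> i * x $ \<phi> i)\<^sup>2) \<le> \<delta> * (norm x)\<^sup>2}"
  have [measurable]: "?U \<in> sets borel"
    by measurable
  let ?K = "\<lambda>r. ennreal (r ^ (m - 1)) * indicator {0<..} r"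
  \<comment> \<open>For fixed \<open>z\<close> the successive substitutions are y i = w i / \<sigma>
    i, then w = s \<eta> in polar coordinates, then s = \<rho> z * r.\<close>
  have slice: "(\<integral>\<^sup>+y. indicator ?U (\<chi> k. if k \<in> range \<phi> then (y :: real^'m) $ inv \<phi> k else z k) \<partial>lborel) =
      ennreal (1 / (\<Prod>i\<in>UNIV. \<sigma> i)) * (\<integral>\<^sup>+\<eta>. \<integral>\<^sup>+r. ennreal (\<rho> z ^ m) * ?K r *
        indicator {..\<delta>} (r\<^sup>2 / (1 + q \<eta> * r\<^sup>2)) * indicator {..<1} (sqrt (1 + q \<eta> * r\<^sup>2) * \<rho> z) \<partial>lborel \<partial>?S)"
    (is "?L = _") if z: "0 < \<rho> z" for z
  proof -
    \<comment> \<open>The slice depends on \<open>z\<close> only through its length.\<close>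
    define U' where "U' = {y :: real^'m. (norm y)\<^sup>2 + (\<rho> z)\<^sup>2 < 1 \<and>
      (\<Sum>i\<in>UNIV. (\<sigma> i * y $ i)\<^sup>2) \<le> \<delta> * ((norm y)\<^sup>2 + (\<rho> z)\<^sup>2)}"
    have [measurable]: "U' \<in> sets borel"
      unfolding U'_def by measurable
    have "(\<chi> k. if k \<in> range \<phi> then y $ inv \<phi> k else z k) \<in> ?U \<longleftrightarrow> y \<in> U'" for y :: "real^'m"
    proof -
      let ?x = "(\<chi> k. if k \<in> range \<phi> then y $ inv \<phi> k else z k) :: real^'n"
      have "(norm ?x)\<^sup>2 = (\<Sum>k\<in>range \<phi>. (?x $ k)\<^sup>2) + (\<Sum>k\<in>J. (?x $ k)\<^sup>2)"
        unfolding norm_sq J_def by (subst sum.union_disjoint[symmetric]) auto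
      also have "(\<Sum>k\<in>range \<phi>. (?x $ k)\<^sup>2) = (norm y)\<^sup>2"
        using \<phi> by (simp add: sum.reindex norm_sq)
      also have "(\<Sum>k\<in>J. (?x $ k)\<^sup>2) = (\<rho> z)\<^sup>2"
        unfolding \<rho>_sq by (rule sum.cong) (auto simp: J_def)
      finally have N: "(norm ?x)\<^sup>2 = (norm y)\<^sup>2 + (\<rho> z)\<^sup>2" .
      moreover have "norm ?x < 1 \<longleftrightarrow> (norm ?x)\<^sup>2 < 1"
        by (simp add: power_less_one_iff)
      ultimately show ?thesis
        using \<phi> by (simp add: U'_def)
    qed
    then have "?L = (\<integral>\<^sup>+y. indicator U' y \<partial>lborel)"
      by (simp add: indicator_def)
    also have "\<dots> = ennreal (\<Prod>i\<in>UNIV. 1 / \<sigma> i) * (\<integral>\<^sup>+w. indicator U' (\<chi> i. (1 / \<sigma> i) * w $ i) \<partial>lborel)"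
      using \<sigma> by (intro nn_integral_lborel_diag) auto
    also have "(\<integral>\<^sup>+w. indicator U' ((\<chi> i. (1 / \<sigma> i) * w $ i) :: real^'m) \<partial>lborel) =
      (\<integral>\<^sup>+\<eta>. \<integral>\<^sup>+s. ennreal (s ^ (DIM(real^'m) - 1)) * indicator {0<..} s *
        indicator U' (\<chi> i. (1 / \<sigma> i) * (s *\<^sub>R \<eta>) $ i) \<partial>lborel \<partial>?S)"
    proof (rule nn_integral_polar)
      have "(\<lambda>w. (\<chi> i. (1 / \<sigma> i) * w $ i) :: real^'m) \<in> borel_measurable borel"
        by (intro borel_measurable_vec_lambda) measurable
      then show "(\<lambda>w. indicator U' ((\<chi> i. (1 / \<sigma> i) * w $ i) :: real^'m) :: ennreal) \<in> borel_measurable borel"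
        by measurable
    qed
    also have "\<dots> = (\<integral>\<^sup>+\<eta>. \<integral>\<^sup>+r. ennreal (\<rho> z ^ m) * ?K r *
        indicator {..\<delta>} (r\<^sup>2 / (1 + q \<eta> * r\<^sup>2)) * indicator {..<1} (sqrt (1 + q \<eta> * r\<^sup>2) * \<rho> z) \<partial>lborel \<partial>?S)"
    proof (rule nn_integral_cong_AE)
      show "AE \<eta> in ?S. (\<integral>\<^sup>+s. ennreal (s ^ (DIM(real^'m) - 1)) * indicator {0<..} s *
        indicator U' (\<chi> i. (1 / \<sigma> i) * (s *\<^sub>R \<eta>) $ i) \<partial>lborel) =
        (\<integral>\<^sup>+r. ennreal (\<rho> z ^ m) * ?K r *
        indicator {..\<delta>} (r\<^sup>2 / (1 + q \<eta> * r\<^sup>2)) * indicator {..<1} (sqrt (1 + q \<eta> * r\<^sup>2) * \<rho> z) \<partial>lborel)"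
        using AE_sphere_measure_norm
      proof eventually_elim
        case (elim \<eta>)
        have N: "(norm ((\<chi> i. (1 / \<sigma> i) * (s *\<^sub>R \<eta>) $ i) :: real^'m))\<^sup>2 = s\<^sup>2 * q \<eta>" for s
          unfolding norm_sq q_def by (simp add: sum_distrib_left power_mult_distrib power_divide)
        have S: "(\<Sum>i\<in>UNIV. (\<sigma> i * ((\<chi> i. (1 / \<sigma> i) * (s *\<^sub>R \<eta>) $ i) :: real^'m) $ i)\<^sup>2) = s\<^sup>2" for s
        proof -
          have "(\<Sum>i\<in>UNIV. (\<sigma> i * ((\<chi> i. (1 / \<sigma> i) * (s *\<^sub>R \<eta>) $ i) :: real^'m) $ i)\<^sup>2) =
              s\<^sup>2 * (\<Sum>i\<in>UNIV. (\<eta> $ i)\<^sup>2)"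
            using \<sigma> by (simp add: sum_distrib_left power_mult_distrib less_imp_neq[OF \<sigma>, symmetric])
          then show ?thesis
            using elim by (simp add: norm_sq[symmetric])
        qed
        have U': "(\<chi> i. (1 / \<sigma> i) * (s *\<^sub>R \<eta>) $ i) \<in> U' \<longleftrightarrow>
            s\<^sup>2 * q \<eta> + (\<rho> z)\<^sup>2 < 1 \<and> s\<^sup>2 \<le> \<delta> * (s\<^sup>2 * q \<eta> + (\<rho> z)\<^sup>2)" for s
          unfolding U'_def mem_Collect_eq N S ..
        let ?V = "\<lambda>s. s\<^sup>2 * q \<eta> + (\<rho> z)\<^sup>2 < 1 \<and> s\<^sup>2 \<le> \<delta> * (s\<^sup>2 * q \<eta> + (\<rho> z)\<^sup>2)"
        have "(\<integral>\<^sup>+s. ennreal (s ^ (DIM(real^'m) - 1)) * indicator {0<..} s *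
            indicator U' (\<chi> i. (1 / \<sigma> i) * (s *\<^sub>R \<eta>) $ i) \<partial>lborel) =
          (\<integral>\<^sup>+s. ?K s * indicator (Collect ?V) s \<partial>lborel)"
          unfolding indicator_def U' by (simp add: m_def)
        also have "\<dots> = ennreal \<bar>\<rho> z\<bar> * (\<integral>\<^sup>+r. ?K (0 + \<rho> z * r) * indicator (Collect ?V) (0 + \<rho> z * r) \<partial>lborel)"
          using z by (intro nn_integral_real_affine) auto
        also have "\<dots> = (\<integral>\<^sup>+r. ennreal \<bar>\<rho> z\<bar> * (?K (0 + \<rho> z * r) * indicator (Collect ?V) (0 + \<rho> z * r)) \<partial>lborel)"
          by (rule nn_integral_cmult[symmetric]) measurable
        also have "\<dots> = (\<integral>\<^sup>+r. ennreal (\<rho> z ^ m) * ?K r *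
            indicator {..\<delta>} (r\<^sup>2 / (1 + q \<eta> * r\<^sup>2)) * indicator {..<1} (sqrt (1 + q \<eta> * r\<^sup>2) * \<rho> z) \<partial>lborel)"
        proof (rule nn_integral_cong)
          fix r :: real
          have c: "0 < 1 + q \<eta> * r\<^sup>2"
            using q_nonneg[of \<eta>] by (simp add: add_pos_nonneg)
          \<comment> \<open>This is the squared norm of the full vector. Its factor
            \<open>(\<rho> z)\<^sup>2\<close> cancels in the cone condition and survives only in the
            ball condition.\<close>
          have eq: "(\<rho> z * r)\<^sup>2 * q \<eta> + (\<rho> z)\<^sup>2 = (\<rho> z)\<^sup>2 * (1 + q \<eta> * r\<^sup>2)"
            by (simp add: algebra_simps power_mult_distrib)
          have "(\<rho> z)\<^sup>2 * (1 + q \<eta> * r\<^sup>2) < 1 \<longleftrightarrow> (sqrt (1 + q \<eta> * r\<^sup>2) * \<rho> z)\<^sup>2 < 1"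
            using c by (simp add: power_mult_distrib mult.commute)
          also have "\<dots> \<longleftrightarrow> sqrt (1 + q \<eta> * r\<^sup>2) * \<rho> z < 1"
            using c \<rho>_nonneg[of z] by (subst power_less_one_iff) auto
          finally have 1: "(\<rho> z)\<^sup>2 * (1 + q \<eta> * r\<^sup>2) < 1 \<longleftrightarrow> sqrt (1 + q \<eta> * r\<^sup>2) * \<rho> z < 1" .
          have "(\<rho> z * r)\<^sup>2 \<le> \<delta> * ((\<rho> z)\<^sup>2 * (1 + q \<eta> * r\<^sup>2)) \<longleftrightarrow>
              (\<rho> z)\<^sup>2 * r\<^sup>2 \<le> (\<rho> z)\<^sup>2 * (\<delta> * (1 + q \<eta> * r\<^sup>2))"
            by (simp add: power_mult_distrib mult_ac)
          also have "\<dots> \<longleftrightarrow> r\<^sup>2 / (1 + q \<eta> * r\<^sup>2) \<le> \<delta>"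
            using z c by (simp add: pos_divide_le_eq)
          finally have "?V (0 + \<rho> z * r) \<longleftrightarrow>
              sqrt (1 + q \<eta> * r\<^sup>2) * \<rho> z < 1 \<and> r\<^sup>2 / (1 + q \<eta> * r\<^sup>2) \<le> \<delta>"
            using 1 by (simp add: eq)
          then have I: "indicator (Collect ?V) (0 + \<rho> z * r) =
              (indicator {..\<delta>} (r\<^sup>2 / (1 + q \<eta> * r\<^sup>2)) * indicator {..<1} (sqrt (1 + q \<eta> * r\<^sup>2) * \<rho> z) :: ennreal)"
            by (auto simp: indicator_def)
          \<comment> \<open>One factor \<open>\<rho> z\<close> is the Jacobian, and the other m - 1
            come from the polar weight.\<close>
          have "ennreal \<bar>\<rho> z\<bar> * ?K (0 + \<rho> z * r) = ennreal (\<rho> z ^ m) * ?K r"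
          proof (cases "0 < r")
            case True
            have "\<rho> z * \<rho> z ^ (m - 1) = \<rho> z ^ m"
              using m by (simp flip: power_Suc)
            then show ?thesis
              using True z by (simp add: ennreal_mult[symmetric] power_mult_distrib mult.assoc[symmetric])
          next
            case False
            then show ?thesis
              using z by (simp add: zero_less_mult_iff)
          qed
          then have K: "ennreal \<bar>\<rho> z\<bar> * ?K (0 + \<rho> z * r) * i = ennreal (\<rho> z ^ m) * ?K r * i" for i
            by simp
          show "ennreal \<bar>\<rho> z\<bar> * (?K (0 + \<rho> z * r) * indicator (Collect ?V) (0 + \<rho> z * r)) =
            ennreal (\<rho> z ^ m) * ?K r * indicator {..\<delta>} (r\<^sup>2 / (1 + q \<eta> * r\<^sup>2)) *
            indicator {..<1} (sqrt (1 + q \<eta> * r\<^sup>2) * \<rho> z)"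
            using K[of "indicator (Collect ?V) (0 + \<rho> z * r)"] unfolding I
            by (simp only: mult.assoc)
        qed
        finally show ?case .
      qed
    qed
    finally show ?thesis
      by (simp add: prod_dividef)
  qed
  have "emeasure lborel ?U = (\<integral>\<^sup>+x. indicator ?U x \<partial>lborel)"
    by simp
  also have "\<dots> = (\<integral>\<^sup>+z. \<integral>\<^sup>+y. indicator ?U (\<chi> k. if k \<in> range \<phi> then (y :: real^'m) $ inv \<phi> k else z k)
      \<partial>lborel \<partial>?P)"
    unfolding J_def by (rule nn_integral_lborel_vec_split[OF \<phi>]) measurable
  also have "\<dots> = (\<integral>\<^sup>+z. ennreal (1 / (\<Prod>i\<in>UNIV. \<sigma> i)) * (\<integral>\<^sup>+\<eta>. \<integral>\<^sup>+r. ennreal (\<rho> z ^ m) * ?K r *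
        indicator {..\<delta>} (r\<^sup>2 / (1 + q \<eta> * r\<^sup>2)) * indicator {..<1} (sqrt (1 + q \<eta> * r\<^sup>2) * \<rho> z)
        \<partial>lborel \<partial>?S) \<partial>?P)"
  proof (rule nn_integral_cong_AE)
    have "AE z in ?P. 0 < \<rho> z"
      using AE_PiM_lborel_component_nonzero[OF finJ j]
    proof eventually_elim
      case (elim z)
      then have "\<rho> z \<noteq> 0"
        using j by (auto simp: \<rho>_def L2_set_eq_0_iff[OF finJ])
      then show ?case
        using \<rho>_nonneg[of z] by simp
    qed
    then show "AE z in ?P. (\<integral>\<^sup>+y. indicator ?U (\<chi> k. if k \<in> range \<phi> then (y :: real^'m) $ inv \<phi> k else z k) \<partial>lborel) =
      ennreal (1 / (\<Prod>i\<in>UNIV. \<sigma> i)) * (\<integral>\<^sup>+\<eta>. \<integral>\<^sup>+r. ennreal (\<rho> z ^ m) * ?K r *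
        indicator {..\<delta>} (r\<^sup>2 / (1 + q \<eta> * r\<^sup>2)) * indicator {..<1} (sqrt (1 + q \<eta> * r\<^sup>2) * \<rho> z)
        \<partial>lborel \<partial>?S)"
      by eventually_elim (rule slice)
  qed
  also have "\<dots> = ennreal (1 / (\<Prod>i\<in>UNIV. \<sigma> i)) * (\<integral>\<^sup>+z. \<integral>\<^sup>+\<eta>. \<integral>\<^sup>+r. ennreal (\<rho> z ^ m) * ?K r *
        indicator {..\<delta>} (r\<^sup>2 / (1 + q \<eta> * r\<^sup>2)) * indicator {..<1} (sqrt (1 + q \<eta> * r\<^sup>2) * \<rho> z)
        \<partial>lborel \<partial>?S \<partial>?P)"
    by (rule nn_integral_cmult) measurable
  \<comment> \<open>Two exchanges move the \<open>z\<close>-integral to the innermost place, where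
    its scaling law separates it from \<open>\<eta>\<close> and \<open>r\<close>.\<close>
  also have "(\<integral>\<^sup>+z. \<integral>\<^sup>+\<eta>. \<integral>\<^sup>+r. ennreal (\<rho> z ^ m) * ?K r *
        indicator {..\<delta>} (r\<^sup>2 / (1 + q \<eta> * r\<^sup>2)) * indicator {..<1} (sqrt (1 + q \<eta> * r\<^sup>2) * \<rho> z)
        \<partial>lborel \<partial>?S \<partial>?P) =
      (\<integral>\<^sup>+\<eta>. \<integral>\<^sup>+z. \<integral>\<^sup>+r. ennreal (\<rho> z ^ m) * ?K r *
        indicator {..\<delta>} (r\<^sup>2 / (1 + q \<eta> * r\<^sup>2)) * indicator {..<1} (sqrt (1 + q \<eta> * r\<^sup>2) * \<rho> z)
        \<partial>lborel \<partial>?P \<partial>?S)"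
    by (rule PS.Fubini') measurable
  also have "\<dots> = (\<integral>\<^sup>+\<eta>. \<integral>\<^sup>+r. \<integral>\<^sup>+z. ennreal (\<rho> z ^ m) * ?K r *
        indicator {..\<delta>} (r\<^sup>2 / (1 + q \<eta> * r\<^sup>2)) * indicator {..<1} (sqrt (1 + q \<eta> * r\<^sup>2) * \<rho> z)
        \<partial>?P \<partial>lborel \<partial>?S)"
    by (intro nn_integral_cong PL.Fubini') measurable
  also have "\<dots> = (\<integral>\<^sup>+\<eta>. (\<integral>\<^sup>+z. ennreal (\<rho> z ^ m) * indicator {..<1} (\<rho> z) \<partial>?P) *
      (\<integral>\<^sup>+r. ?K r * indicator {..\<delta>} (r\<^sup>2 / (1 + q \<eta> * r\<^sup>2)) * ennreal ((1 / sqrt (1 + q \<eta> * r\<^sup>2)) ^ n)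
        \<partial>lborel) \<partial>?S)"
  proof (rule nn_integral_cong)
    fix \<eta> :: "real^'m"
    let ?C = "\<integral>\<^sup>+z. ennreal (\<rho> z ^ m) * indicator {..<1} (\<rho> z) \<partial>?P"
    have "(\<integral>\<^sup>+z. ennreal (\<rho> z ^ m) * ?K r *
        indicator {..\<delta>} (r\<^sup>2 / (1 + q \<eta> * r\<^sup>2)) * indicator {..<1} (sqrt (1 + q \<eta> * r\<^sup>2) * \<rho> z) \<partial>?P) =
      ?C * (?K r * indicator {..\<delta>} (r\<^sup>2 / (1 + q \<eta> * r\<^sup>2)) * ennreal ((1 / sqrt (1 + q \<eta> * r\<^sup>2)) ^ n))" for r
    proof -
      have c: "0 < sqrt (1 + q \<eta> * r\<^sup>2)"
        using q_nonneg[of \<eta>] by (simp add: add_pos_nonneg)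
      have "(\<integral>\<^sup>+z. ennreal (\<rho> z ^ m) * ?K r *
          indicator {..\<delta>} (r\<^sup>2 / (1 + q \<eta> * r\<^sup>2)) * indicator {..<1} (sqrt (1 + q \<eta> * r\<^sup>2) * \<rho> z) \<partial>?P) =
        (\<integral>\<^sup>+z. (?K r * indicator {..\<delta>} (r\<^sup>2 / (1 + q \<eta> * r\<^sup>2))) *
          (ennreal (\<rho> z ^ m) * indicator {..<1} (sqrt (1 + q \<eta> * r\<^sup>2) * \<rho> z)) \<partial>?P)"
        by (simp add: mult_ac)
      also have "\<dots> = (?K r * indicator {..\<delta>} (r\<^sup>2 / (1 + q \<eta> * r\<^sup>2))) *
          (\<integral>\<^sup>+z. ennreal (\<rho> z ^ m) * indicator {..<1} (sqrt (1 + q \<eta> * r\<^sup>2) * \<rho> z) \<partial>?P)"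
        by (rule nn_integral_cmult) measurable
      also have "(\<integral>\<^sup>+z. ennreal (\<rho> z ^ m) * indicator {..<1} (sqrt (1 + q \<eta> * r\<^sup>2) * \<rho> z) \<partial>?P) =
          ennreal ((1 / sqrt (1 + q \<eta> * r\<^sup>2)) ^ n) * ?C"
        unfolding \<rho>_def using nn_integral_L2_set_scale[OF finJ c, of m] by (simp add: cardJ)
      finally show ?thesis
        by (simp add: mult_ac)
    qed
    then show "(\<integral>\<^sup>+r. \<integral>\<^sup>+z. ennreal (\<rho> z ^ m) * ?K r *
        indicator {..\<delta>} (r\<^sup>2 / (1 + q \<eta> * r\<^sup>2)) * indicator {..<1} (sqrt (1 + q \<eta> * r\<^sup>2) * \<rho> z)
        \<partial>?P \<partial>lborel) =
      ?C * (\<integral>\<^sup>+r. ?K r * indicator {..\<delta>} (r\<^sup>2 / (1 + q \<eta> * r\<^sup>2)) *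
        ennreal ((1 / sqrt (1 + q \<eta> * r\<^sup>2)) ^ n) \<partial>lborel)"
      by (simp only:) (rule nn_integral_cmult, measurable)
  qed
  also have "\<dots> = (\<integral>\<^sup>+z. ennreal (\<rho> z ^ m) * indicator {..<1} (\<rho> z) \<partial>?P) *
      (\<integral>\<^sup>+\<eta>. \<integral>\<^sup>+r. ?K r * indicator {..\<delta>} (r\<^sup>2 / (1 + q \<eta> * r\<^sup>2)) *
        ennreal ((1 / sqrt (1 + q \<eta> * r\<^sup>2)) ^ n) \<partial>lborel \<partial>?S)"
    by (rule nn_integral_cmult) measurable
  also have "(\<integral>\<^sup>+\<eta>. \<integral>\<^sup>+r. ?K r * indicator {..\<delta>} (r\<^sup>2 / (1 + q \<eta> * r\<^sup>2)) *
        ennreal ((1 / sqrt (1 + q \<eta> * r\<^sup>2)) ^ n) \<partial>lborel \<partial>?S) =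
      (\<integral>\<^sup>+\<eta>. \<integral>\<^sup>+t. ennreal (t powr (m / 2 - 1) *
        (max 0 (1 - t * q \<eta>)) powr ((real n - real m) / 2 - 1) / 2) * indicator {0<..\<delta>} t \<partial>lborel \<partial>?S)"
  \<comment> \<open>The radial substitution needs \<open>q \<eta>\<close> to be positive, which is
    known for unit vectors, hence almost everywhere.\<close>
  proof (rule nn_integral_cong_AE)
    show "AE \<eta> in ?S. (\<integral>\<^sup>+r. ?K r * indicator {..\<delta>} (r\<^sup>2 / (1 + q \<eta> * r\<^sup>2)) *
        ennreal ((1 / sqrt (1 + q \<eta> * r\<^sup>2)) ^ n) \<partial>lborel) =
      (\<integral>\<^sup>+t. ennreal (t powr (m / 2 - 1) *
        (max 0 (1 - t * q \<eta>)) powr ((real n - real m) / 2 - 1) / 2) * indicator {0<..\<delta>} t \<partial>lborel)"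
      using AE_sphere_measure_norm
      by eventually_elim (rule nn_integral_radial_substitution_power[OF q_pos m mn])
  qed
  finally show ?thesis
    by (simp add: q_def \<rho>_def mult_ac)
qed

section \<open>The density\<close>

text \<open>The factor 1/2 is the one left by the radial substitution. At t = 0 the half-open and
  the closed range agree because \<open>0 powr (a - 1)\<close> is 0.\<close>

lemma nn_integral_Beta:
  fixes a b :: real
  assumes "0 < a" "0 < b"
  shows "(\<integral>\<^sup>+t. ennreal (t powr (a - 1) * (max 0 (1 - t)) powr (b - 1) / 2) * indicator {0<..1} t \<partial>lborel) =
    ennreal (Beta a b / 2)"
proof -
  have "((\<lambda>t. t powr (a - 1) * (1 - t) powr (b - 1) / 2) has_integral Beta a b / 2) {0..1}"
    by (intro has_integral_divide has_integral_Beta_real assms)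
  then have "(\<integral>\<^sup>+t. ennreal (t powr (a - 1) * (1 - t) powr (b - 1) / 2) * indicator {0..1} t \<partial>lborel) =
      ennreal (Beta a b / 2)"
    by (intro nn_integral_has_integral_lebesgue') auto
  moreover have "ennreal (t powr (a - 1) * (max 0 (1 - t)) powr (b - 1) / 2) * indicator {0<..1} t =
      ennreal (t powr (a - 1) * (1 - t) powr (b - 1) / 2) * indicator {0..1} t" for t
    by (cases "t = 0") (auto simp: indicator_def max_def)
  ultimately show ?thesis
    by simp
qed

lemma Beta_pos: "0 < a \<Longrightarrow> 0 < b \<Longrightarrow> 0 < Beta a (b :: real)"
  by (simp add: Beta_def Gamma_real_pos)

text \<open>With all singular values and \<open>\<delta>\<close> equal to 1 the cone is the whole
  unit ball, as part of the coordinates cannot exceed the full norm. Then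
  \<open>emeasure_cone\<close> is an equation for \<open>?C\<close> whose other factor is the area
  \<open>m * unit_ball_vol m\<close> times half a Beta value.\<close>

lemma nn_integral_L2_set_power:
  fixes \<phi> :: "'m::finite \<Rightarrow> 'n::finite"
  defines "J \<equiv> - range \<phi>" and "m \<equiv> CARD('m)" and "n \<equiv> CARD('n)"
  assumes \<phi>: "inj \<phi>" and mn: "m < n"
  shows "(\<integral>\<^sup>+z. ennreal (L2_set z J ^ m) * indicator {..<1} (L2_set z J) \<partial>PiM J (\<lambda>_. lborel)) =
    ennreal (2 * unit_ball_vol n / (m * unit_ball_vol m * Beta (m / 2) ((real n - real m) / 2)))"
    (is "?C = _")
proof -
  let ?b = "m * unit_ball_vol m * Beta (m / 2) ((real n - real m) / 2)"
  have m: "0 < m" by (simp add: m_def)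
  have B: "0 < Beta (m / 2) ((real n - real m) / 2)"
    using m mn by (intro Beta_pos) auto
  then have b: "0 < ?b"
    using m by simp
  have "(\<Sum>i\<in>UNIV. (1 * x $ \<phi> i)\<^sup>2) \<le> 1 * (norm x)\<^sup>2" for x :: "real^'n"
  proof -
    have "(\<Sum>i\<in>UNIV. (1 * x $ \<phi> i)\<^sup>2) = (\<Sum>k\<in>range \<phi>. (x $ k)\<^sup>2)"
      using \<phi> by (simp add: sum.reindex)
    also have "\<dots> \<le> (\<Sum>k\<in>UNIV. (x $ k)\<^sup>2)"
      by (rule sum_mono2) auto
    finally show ?thesis
      by (simp add: norm_vec_def L2_set_def sum_nonneg)
  qed
  then have "{x :: real^'n. norm x < 1 \<and> (\<Sum>i\<in>UNIV. (1 * x $ \<phi> i)\<^sup>2) \<le> 1 * (norm x)\<^sup>2} = ball 0 1"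
    by auto
  then have "emeasure lborel {x :: real^'n. norm x < 1 \<and> (\<Sum>i\<in>UNIV. (1 * x $ \<phi> i)\<^sup>2) \<le> 1 * (norm x)\<^sup>2} =
      ennreal (unit_ball_vol n)"
    by (simp add: emeasure_ball n_def)
  then have "ennreal (unit_ball_vol n) = ?C * (\<integral>\<^sup>+\<eta>. \<integral>\<^sup>+t. ennreal (t powr (m / 2 - 1) *
      (max 0 (1 - t * (\<Sum>i\<in>UNIV. ((\<eta> :: real^'m) $ i)\<^sup>2))) powr ((real n - real m) / 2 - 1) / 2) *
      indicator {0<..1} t \<partial>lborel \<partial>sphere_measure)"
    using emeasure_cone[of \<phi> "\<lambda>_. 1" 1] \<phi> mn by (simp add: J_def m_def n_def)
  also have "(\<integral>\<^sup>+\<eta>. \<integral>\<^sup>+t. ennreal (t powr (m / 2 - 1) *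
      (max 0 (1 - t * (\<Sum>i\<in>UNIV. ((\<eta> :: real^'m) $ i)\<^sup>2))) powr ((real n - real m) / 2 - 1) / 2) *
      indicator {0<..1} t \<partial>lborel \<partial>sphere_measure) =
    (\<integral>\<^sup>+\<eta>. ennreal (Beta (m / 2) ((real n - real m) / 2) / 2) \<partial>(sphere_measure :: (real^'m) measure))"
  proof (rule nn_integral_cong_AE)
    show "AE \<eta> in sphere_measure. (\<integral>\<^sup>+t. ennreal (t powr (m / 2 - 1) *
      (max 0 (1 - t * (\<Sum>i\<in>UNIV. ((\<eta> :: real^'m) $ i)\<^sup>2))) powr ((real n - real m) / 2 - 1) / 2) *
      indicator {0<..1} t \<partial>lborel) = ennreal (Beta (m / 2) ((real n - real m) / 2) / 2)"
      using AE_sphere_measure_norm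
    proof eventually_elim
      case (elim \<eta>)
      then have "(\<Sum>i\<in>UNIV. (\<eta> $ i)\<^sup>2) = 1"
        by (simp add: norm_vec_def L2_set_def)
      then show ?case
        using nn_integral_Beta[of "m / 2" "(real n - real m) / 2"] m mn by simp
    qed
  qed
  also have "\<dots> = ennreal (?b / 2)"
    using B by (simp add: emeasure_sphere_measure_UNIV m_def ennreal_mult[symmetric] mult_ac)
  finally have "ennreal (unit_ball_vol n) / ennreal (?b / 2) = ?C * ennreal (?b / 2) / ennreal (?b / 2)"
    by simp
  also have "\<dots> = ?C"
    using b by (intro mult_divide_eq_ennreal) (auto simp: ennreal_eq_0_iff)
  finally have "?C = ennreal (unit_ball_vol n / (?b / 2))"
    using b by (subst (asm) divide_ennreal) auto
  then show ?thesis
    by (simp add: mult.commute)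
qed

text \<open>\<open>matrix_inv\<close> is a choice, so it is identified by uniqueness: the diagonal
  matrix of reciprocals is a two-sided inverse, and the chosen left inverse must equal it.\<close>

lemma matrix_inv_diag_mult:
  fixes \<sigma> :: "'m::finite \<Rightarrow> real"
  assumes "\<And>i. \<sigma> i \<noteq> 0"
  shows "matrix_inv (diag \<sigma>) *v x = (\<chi> i. x $ i / \<sigma> i)"
proof -
  have mult: "diag d *v y = (\<chi> i. d i * y $ i)" for d :: "'m \<Rightarrow> real" and y
    by (simp add: diag_def matrix_vector_mult_def vec_eq_iff if_distrib[of "\<lambda>u. u * _"] cong: if_cong)
  have "diag d ** diag e = diag (\<lambda>i. d i * e i)" for d e :: "'m \<Rightarrow> real"
    by (simp add: matrix_eq matrix_vector_mul_assoc[symmetric] mult vec_eq_iff)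
  moreover have "diag (\<lambda>_. 1) = (mat 1 :: real^'m^'m)"
    by (simp add: diag_def mat_def)
  ultimately have inv: "diag \<sigma> ** diag (\<lambda>i. 1 / \<sigma> i) = mat 1" "diag (\<lambda>i. 1 / \<sigma> i) ** diag \<sigma> = mat 1"
    using assms by simp_all
  have "matrix_inv (diag \<sigma>) ** diag \<sigma> = mat 1"
    unfolding matrix_inv_def by (rule someI2[where a = "diag (\<lambda>i. 1 / \<sigma> i)"]) (use inv in auto)
  then have "matrix_inv (diag \<sigma>) = diag (\<lambda>i. 1 / \<sigma> i)"
    using inv by (metis matrix_mul_assoc matrix_mul_lid matrix_mul_rid)
  then show ?thesis
    by (simp add: mult)
qed

text \<open>Both sides of the condition are homogeneous of degree 2, so \<open>sgn x\<close>
  satisfies it exactly when \<open>x\<close> does. The dimension factor of the surface measure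
  cancels against the one in the area of the sphere.\<close>

lemma sphere_prob_cone:
  fixes T :: "real^'m^'n"
  shows "sphere_prob {\<omega>. (norm (transpose T *v \<omega>))\<^sup>2 \<le> \<delta> * (norm \<omega>)\<^sup>2} =
    measure lborel {x. norm x < 1 \<and> (norm (transpose T *v x))\<^sup>2 \<le> \<delta> * (norm x)\<^sup>2} / unit_ball_vol CARD('n)"
proof -
  let ?M = "{\<omega>. (norm (transpose T *v \<omega>))\<^sup>2 \<le> \<delta> * (norm \<omega>)\<^sup>2}"
  let ?W = "{x. norm x < 1 \<and> (norm (transpose T *v x))\<^sup>2 \<le> \<delta> * (norm x)\<^sup>2}"
  have "continuous_on UNIV ((*v) (transpose T))"
    by (intro linear_continuous_on matrix_vector_mul_bounded_linear)
  then have [measurable]: "(*v) (transpose T) \<in> borel_measurable borel"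
    by (rule borel_measurable_continuous_onI)
  have [measurable]: "?M \<in> sets borel" "?W \<in> sets borel"
    by measurable
  have MS: "?M \<inter> sphere 0 1 \<in> sets borel"
    using \<open>?M \<in> sets borel\<close> borel_closed[OF closed_sphere] by (rule sets.Int)
  have sgn: "sgn x \<in> ?M \<longleftrightarrow> x \<in> ?M" if "x \<noteq> 0" for x
  proof -
    have "sgn x \<in> ?M \<longleftrightarrow> (norm (transpose T *v x))\<^sup>2 / (norm x)\<^sup>2 \<le> \<delta>"
      using that by (simp add: norm_sgn sgn_div_norm matrix_vector_mult_scaleR power_mult_distrib
          power_divide divide_inverse mult.commute power_inverse del: transpose_matrix_vector)
    then show ?thesis
      using that by (simp add: pos_divide_le_eq del: transpose_matrix_vector)
  qed
  have "emeasure sphere_measure (?M \<inter> sphere 0 1) =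
      of_nat CARD('n) * emeasure lborel {x \<in> ball 0 1 - {0}. sgn x \<in> ?M \<inter> sphere 0 1}"
    using emeasure_sphere_measure[OF MS] by simp
  also have "{x \<in> ball 0 1 - {0}. sgn x \<in> ?M \<inter> sphere 0 1} = ?W - {0}"
    using sgn by (auto simp: norm_sgn)
  also have "emeasure lborel (?W - {0}) = emeasure lborel ?W"
    by (rule emeasure_Diff_null_set)
      (use \<open>?W \<in> sets borel\<close> in \<open>auto simp del: transpose_matrix_vector\<close>)
  finally have "measure sphere_measure (?M \<inter> sphere 0 1) = CARD('n) * measure lborel ?W"
    by (simp add: measure_def enn2real_mult)
  then show ?thesis
    using MS by (simp add: sphere_prob_def set_lebesgue_integral_def)
qed

theorem theorem3p1:
  fixes T :: "real^'m^'n" and \<sigma> :: "'m \<Rightarrow> real" and F f :: "real \<Rightarrow> real"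
    and \<alpha> \<beta> :: real and \<Sigma>\<^sub>0 :: "real^'m^'m"
  assumes "1 \<le> CARD('m)" and "CARD('m) < CARD('n)" and "CARD('n) - CARD('m) > 2"
    and "rank T = CARD('m)"
    and "singular_values T \<sigma>"
    and "\<Sigma>\<^sub>0 = diag \<sigma>"
    and "\<alpha> = real CARD('m) / 2"
    and "\<beta> = (real CARD('n) - real CARD('m)) / 2"
    and "\<And>\<delta>. F \<delta> =
           sphere_prob {\<omega> :: real^'n. (norm (transpose T *v \<omega>))\<^sup>2 \<le> \<delta> * (norm \<omega>)\<^sup>2}"
    and "\<And>t. t \<le> 0 \<Longrightarrow> f t = 0"
    and "\<And>t. t > 0 \<Longrightarrow> f t =
           1 / Beta \<alpha> \<beta> * (1 / (real CARD('m) * unit_ball_vol (real CARD('m)))) *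
           (LINT \<eta> : sphere (0 :: real^'m) 1 | sphere_measure.
              t powr (\<alpha> - 1) *
              (max 0 (1 - t * (norm (matrix_inv \<Sigma>\<^sub>0 *v \<eta>))\<^sup>2)) powr (\<beta> - 1) / det \<Sigma>\<^sub>0)"
  shows "\<forall>\<delta>. set_integrable lborel {..\<delta>} f \<and> F \<delta> = (LINT t : {..\<delta>} | lborel. f t)"
proof -
  let ?S = "sphere_measure :: (real^'m) measure"
  let ?\<nu> = "unit_ball_vol CARD('n)"
  have \<nu>: "0 < ?\<nu>" "?\<nu> \<noteq> 0"
    using unit_ball_vol_pos[of "real CARD('n)", OF of_nat_0_le_iff] by (blast, metis less_irrefl)
  \<comment> \<open>Any injection will do: it selects the coordinates on which the singular values
    act after a rotation.\<close>
  obtain \<phi> :: "'m \<Rightarrow> 'n" where \<phi>: "inj \<phi>"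
    using assms(2) inj_on_iff_card_le[of "UNIV :: 'm set" "UNIV :: 'n set"] by auto
  have \<sigma>: "0 < \<sigma> i" for i
    by (rule singular_values_pos[OF assms(4,5)])
  obtain P :: "real^'n^'n" where P: "orthogonal_matrix P"
    "\<And>x. (norm (transpose T *v x))\<^sup>2 = (\<Sum>i\<in>UNIV. (\<sigma> i * (P *v x) $ \<phi> i)\<^sup>2)"
    using singular_value_decomposition[OF assms(4,5) \<phi>] by blast
  define D where "D = (\<Prod>i\<in>UNIV. \<sigma> i)"
  have D: "0 < D"
    unfolding D_def using \<sigma> by (simp add: prod_pos)
  have det: "det \<Sigma>\<^sub>0 = D"
    unfolding assms(6) D_def by (subst det_diagonal) (simp_all add: diag_def)
  define q where "q \<eta> = (\<Sum>i\<in>UNIV. (\<eta> $ i / \<sigma> i)\<^sup>2)" for \<eta> :: "real^'m"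
  have q: "(norm (matrix_inv \<Sigma>\<^sub>0 *v \<eta>))\<^sup>2 = q \<eta>" for \<eta>
  proof -
    have "\<sigma> i \<noteq> 0" for i
      using \<sigma>[of i] by simp
    then show ?thesis
      by (simp add: assms(6) matrix_inv_diag_mult q_def norm_vec_def L2_set_def sum_nonneg power_divide)
  qed
  have q_nonneg: "0 \<le> q \<eta>" for \<eta>
    by (simp add: q_def sum_nonneg)
  have [measurable]: "sphere 0 1 \<in> sets (borel :: (real^'m) measure)"
    by simp
  have [measurable]: "q \<in> borel_measurable borel"
    unfolding q_def[abs_def] by measurable
  have \<alpha>\<beta>: "0 < \<alpha>" "1 < \<beta>"
    using assms(1,3) by (auto simp: assms(7,8))
  define h where "h \<eta> t = t powr (\<alpha> - 1) * (max 0 (1 - t * q \<eta>)) powr (\<beta> - 1)" for \<eta> t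
  have h_nonneg: "0 \<le> h \<eta> t" for \<eta> t
    by (simp add: h_def)
  have [measurable]: "(\<lambda>p. h (fst p) (snd p)) \<in> borel_measurable (borel \<Otimes>\<^sub>M borel)"
    unfolding h_def by measurable
  have [measurable]: "(\<lambda>\<eta>. h \<eta> t) \<in> borel_measurable borel" for t
    unfolding h_def by measurable
  have [measurable]: "h \<eta> \<in> borel_measurable borel" for \<eta>
    unfolding h_def[abs_def] by measurable
  define \<kappa> where "\<kappa> = 1 / (Beta \<alpha> \<beta> * (real CARD('m) * unit_ball_vol (real CARD('m))))"
  have \<kappa>: "0 < \<kappa>"
    using \<alpha>\<beta> Beta_pos[of \<alpha> \<beta>] by (simp add: \<kappa>_def)
  interpret S: finite_measure ?S
    by (rule finite_measure_sphere_measure)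
  interpret SL: pair_sigma_finite ?S "lborel :: real measure" ..
  have f_eq: "f t = (if t \<le> 0 then 0 else \<kappa> * (\<integral>\<eta>. indicator (sphere 0 1) \<eta> * (h \<eta> t / D) \<partial>?S))" for t
  proof (cases "t \<le> 0")
    case False
    then have "0 < t" by simp
    from assms(11)[OF this]
    have "f t = 1 / Beta \<alpha> \<beta> * (1 / (real CARD('m) * unit_ball_vol (real CARD('m)))) *
        (\<integral>\<eta>. indicator (sphere 0 1) \<eta> *\<^sub>R (h \<eta> t / D) \<partial>?S)"
      unfolding set_lebesgue_integral_def q det h_def .
    then show ?thesis
      using False by (simp add: \<kappa>_def)
  qed (simp add: assms(10))
  have [measurable]: "f \<in> borel_measurable borel"
    unfolding f_eq[abs_def] h_def by measurable
  have f_nonneg: "0 \<le> f t" for t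
    unfolding f_eq using \<kappa> D h_nonneg by (auto intro!: mult_nonneg_nonneg integral_nonneg_AE)
  \<comment> \<open>Passing from the Lebesgue integral in \<open>f\<close> to the nonnegative one
    requires integrability. From n - m > 2 comes \<beta> > 1, so the truncated power is at most 1
    and the integrand is at most \<open>t powr (\<alpha> - 1) / D\<close> on a finite measure
    space.\<close>
  have ennreal_f: "ennreal (f t) = ennreal \<kappa> * (ennreal (1 / D) * (\<integral>\<^sup>+\<eta>. ennreal (h \<eta> t) \<partial>?S))"
    if t: "0 < t" for t
  proof -
    have "integrable ?S (\<lambda>\<eta>. indicator (sphere 0 1) \<eta> * (h \<eta> t / D))"
    proof (rule S.integrable_const_bound)
      have "norm (indicator (sphere 0 1) \<eta> * (h \<eta> t / D)) \<le> t powr (\<alpha> - 1) / D" for \<eta>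
      proof -
        have "(max 0 (1 - t * q \<eta>)) powr (\<beta> - 1) \<le> 1"
          using \<alpha>\<beta> t q_nonneg[of \<eta>] by (intro powr_le1) auto
        then have "h \<eta> t \<le> t powr (\<alpha> - 1)"
          unfolding h_def by (intro mult_left_le) auto
        then show ?thesis
          using D h_nonneg[of \<eta> t] by (auto simp: indicator_def divide_right_mono)
      qed
      then show "AE \<eta> in ?S. norm (indicator (sphere 0 1) \<eta> * (h \<eta> t / D)) \<le> t powr (\<alpha> - 1) / D"
        by simp
    qed measurable
    then have "ennreal (\<integral>\<eta>. indicator (sphere 0 1) \<eta> * (h \<eta> t / D) \<partial>?S) =
        (\<integral>\<^sup>+\<eta>. ennreal (indicator (sphere 0 1) \<eta> * (h \<eta> t / D)) \<partial>?S)"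
      using D h_nonneg by (intro nn_integral_eq_integral[symmetric]) auto
    also have "\<dots> = (\<integral>\<^sup>+\<eta>. ennreal (1 / D) * ennreal (h \<eta> t) \<partial>?S)"
    proof (rule nn_integral_cong_AE)
      show "AE \<eta> in ?S. ennreal (indicator (sphere 0 1) \<eta> * (h \<eta> t / D)) = ennreal (1 / D) * ennreal (h \<eta> t)"
        using AE_sphere_measure_norm
        by eventually_elim (use D h_nonneg in \<open>simp add: ennreal_mult[symmetric]\<close>)
    qed
    also have "\<dots> = ennreal (1 / D) * (\<integral>\<^sup>+\<eta>. ennreal (h \<eta> t) \<partial>?S)"
      by (rule nn_integral_cmult) measurable
    finally have "ennreal (\<integral>\<eta>. indicator (sphere 0 1) \<eta> * (h \<eta> t / D) \<partial>?S) =
        ennreal (1 / D) * (\<integral>\<^sup>+\<eta>. ennreal (h \<eta> t) \<partial>?S)" .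
    moreover have "f t = \<kappa> * (\<integral>\<eta>. indicator (sphere 0 1) \<eta> * (h \<eta> t / D) \<partial>?S)"
      using f_eq[of t] t by simp
    ultimately show ?thesis
      using \<kappa> by (simp only: ennreal_mult' less_imp_le)
  qed
  \<comment> \<open>Working in the extended nonnegative reals, the exchange of the integrals over
    \<open>t\<close> and \<eta> needs only measurability.\<close>
  have int_f: "(\<integral>\<^sup>+t. ennreal (f t) * indicator {..\<delta>} t \<partial>lborel) = ennreal (F \<delta>)" for \<delta>
  proof -
    let ?W = "{x. norm x < 1 \<and> (norm (transpose T *v x))\<^sup>2 \<le> \<delta> * (norm x)\<^sup>2}"
    let ?U = "{x :: real^'n. norm x < 1 \<and> (\<Sum>i\<in>UNIV. (\<sigma> i * x $ \<phi> i)\<^sup>2) \<le> \<delta> * (norm x)\<^sup>2}"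
    let ?I = "\<integral>\<^sup>+\<eta>. \<integral>\<^sup>+t. ennreal (h \<eta> t / 2) * indicator {0<..\<delta>} t \<partial>lborel \<partial>?S"
    have "(\<integral>\<^sup>+t. ennreal (f t) * indicator {..\<delta>} t \<partial>lborel) =
        (\<integral>\<^sup>+t. \<integral>\<^sup>+\<eta>. ennreal (2 * \<kappa> / D) * (ennreal (h \<eta> t / 2) * indicator {0<..\<delta>} t) \<partial>?S \<partial>lborel)"
    proof (rule nn_integral_cong)
      fix t
      \<comment> \<open>The factor 2 compensates the 1/2 carried by the integrand in
        \<open>emeasure_cone\<close>.\<close>
      have *: "ennreal (2 * \<kappa> / D) * ennreal (h \<eta> t / 2) = ennreal \<kappa> * ennreal (1 / D) * ennreal (h \<eta> t)" for \<eta>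
        using \<kappa> D h_nonneg by (simp flip: ennreal_mult)
      show "ennreal (f t) * indicator {..\<delta>} t =
          (\<integral>\<^sup>+\<eta>. ennreal (2 * \<kappa> / D) * (ennreal (h \<eta> t / 2) * indicator {0<..\<delta>} t) \<partial>?S)"
      proof (cases "0 < t \<and> t \<le> \<delta>")
        case True
        then show ?thesis
          by (simp add: ennreal_f * nn_integral_cmult mult.assoc)
      next
        case False
        then have "ennreal (f t) * indicator {..\<delta>} t = 0" "indicator {0<..\<delta>} t = (0 :: ennreal)"
          using f_eq[of t] by (auto simp: indicator_def)
        then show ?thesis
          by simp
      qed
    qed
    also have "\<dots> = (\<integral>\<^sup>+\<eta>. \<integral>\<^sup>+t. ennreal (2 * \<kappa> / D) * (ennreal (h \<eta> t / 2) * indicator {0<..\<delta>} t) \<partial>lborel \<partial>?S)"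
      unfolding h_def by (rule SL.Fubini') measurable
    also have "\<dots> = (\<integral>\<^sup>+\<eta>. ennreal (2 * \<kappa> / D) * (\<integral>\<^sup>+t. ennreal (h \<eta> t / 2) * indicator {0<..\<delta>} t \<partial>lborel) \<partial>?S)"
      by (intro nn_integral_cong nn_integral_cmult) measurable
    also have "\<dots> = ennreal (2 * \<kappa> / D) * ?I"
      unfolding h_def by (rule nn_integral_cmult) measurable
    finally have int: "(\<integral>\<^sup>+t. ennreal (f t) * indicator {..\<delta>} t \<partial>lborel) = ennreal (2 * \<kappa> / D) * ?I" .
    have "orthogonal_transformation ((*v) P)"
      using P(1) by (simp add: orthogonal_transformation_matrix)
    \<comment> \<open>Rotation by \<open>P\<close> carries the cone written in coordinates to the
      cone of \<open>transpose T\<close> without changing its volume.\<close>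
    then have "emeasure lborel ?U = emeasure (distr lborel borel ((*v) P)) ?U"
      by (simp add: distr_lborel_orthogonal_transformation)
    also have "\<dots> = emeasure lborel ((*v) P -` ?U)"
    proof (subst emeasure_distr)
      have "continuous_on UNIV ((*v) P)"
        by (intro linear_continuous_on matrix_vector_mul_bounded_linear)
      then show "(*v) P \<in> measurable lborel borel"
        by (simp add: borel_measurable_continuous_onI)
      show "?U \<in> sets borel"
        by measurable
    qed simp
    also have "(*v) P -` ?U = ?W"
      by (auto simp: P norm_orthogonal_matrix_mult simp del: transpose_matrix_vector)
    finally have "emeasure lborel ?W = emeasure lborel ?U" ..
    \<comment> \<open>The constant found in \<open>nn_integral_L2_set_power\<close> is
      \<open>2 * \<kappa> * ?\<nu>\<close>.\<close>
    also have "\<dots> = ennreal (2 * \<kappa> * ?\<nu>) * (ennreal (1 / D) * ?I)"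
      using emeasure_cone[where \<delta> = \<delta>, OF \<phi> assms(2) \<sigma>] nn_integral_L2_set_power[OF \<phi> assms(2)]
      by (simp add: \<kappa>_def D_def h_def q_def assms(7,8) mult_ac)
    also have "\<dots> = (ennreal (2 * \<kappa> * ?\<nu>) * ennreal (1 / D)) * ?I"
      by (simp only: mult.assoc)
    also have "ennreal (2 * \<kappa> * ?\<nu>) * ennreal (1 / D) = ennreal ?\<nu> * ennreal (2 * \<kappa> / D)"
      using \<kappa> D by (simp flip: ennreal_mult add: mult_ac)
    finally have W: "emeasure lborel ?W = ennreal ?\<nu> * (\<integral>\<^sup>+t. ennreal (f t) * indicator {..\<delta>} t \<partial>lborel)"
      by (simp only: int mult.assoc)
    have "emeasure lborel ?W \<le> emeasure lborel (ball 0 1 :: (real^'n) set)"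
      by (rule emeasure_mono) auto
    also have "\<dots> < top"
      by (simp add: emeasure_ball)
    finally have "emeasure lborel ?W = ennreal (measure lborel ?W)"
      by (simp add: emeasure_eq_ennreal_measure)
    also have "measure lborel ?W = F \<delta> * ?\<nu>"
      unfolding assms(9) sphere_prob_cone using \<nu> by simp
    finally have "ennreal (F \<delta> * ?\<nu>) = (\<integral>\<^sup>+t. ennreal (f t) * indicator {..\<delta>} t \<partial>lborel) * ennreal ?\<nu>"
      using W by (simp add: mult.commute)
    moreover have "0 \<le> F \<delta>"
      unfolding assms(9) sphere_prob_cone by simp
    ultimately have "ennreal (F \<delta>) * ennreal ?\<nu> / ennreal ?\<nu> =
        (\<integral>\<^sup>+t. ennreal (f t) * indicator {..\<delta>} t \<partial>lborel) * ennreal ?\<nu> / ennreal ?\<nu>"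
      by (simp add: ennreal_mult)
    then show ?thesis
      using \<nu> by (simp add: mult_divide_eq_ennreal ennreal_eq_0_iff)
  qed
  show ?thesis
  proof (intro allI conjI)
    fix \<delta>
    have int: "(\<integral>\<^sup>+t. ennreal (indicator {..\<delta>} t * f t) \<partial>lborel) = ennreal (F \<delta>)"
      unfolding int_f[symmetric] by (intro nn_integral_cong) (simp add: indicator_def)
    have nonneg: "0 \<le> indicator {..\<delta>} t * f t" for t
      using f_nonneg by simp
    have F_nonneg: "0 \<le> F \<delta>"
      unfolding assms(9) sphere_prob_cone by simp
    have "(\<lambda>t. indicator {..\<delta>} t * f t) \<in> borel_measurable lborel"
      by measurable
    \<comment> \<open>A nonnegative measurable function with finite nonnegative integral is
      integrable with that value, which gives both conclusions at once.\<close>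
    then have "has_bochner_integral lborel (\<lambda>t. indicator {..\<delta>} t * f t) (F \<delta>)"
      using int nonneg F_nonneg by (intro has_bochner_integral_nn_integral) auto
    then show "set_integrable lborel {..\<delta>} f" "F \<delta> = (LINT t : {..\<delta>} | lborel. f t)"
      by (simp_all add: set_integrable_def set_lebesgue_integral_def has_bochner_integral_iff)
  qed
qed

end
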